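(* Let the following assumptions hold: (A1) The diagonal entries $\omega_j$ of $\Omega$ form an increasing sequence of distinct real numbers, i.e., $0<\omega_1<\omega_2<\ldots$, and $c_j\neq 0$ for all $j\in\mathbb N$. (A2) There exists a constant $\kappa>0$ such that $\omega_{j+1}-\omega_j\geq\kappa$, $j=1,2,\ldots$. (A3) There exist constants $\alpha>0$, $\beta>0$, and $k_0\in\mathbb N$ such that $|c_k|\,\omega_k^{\alpha/2}\geq\beta$ for all $k\geq k_0$. Then every solution $\varepsilon(t)$, $t\ge 0$, of the system $\dot\varepsilon = A\varepsilon$ with $\varepsilon(0)\in D(A)$ satisfies the estimate $$\|\varepsilon(t)\|\leq\tilde\beta\,(t+1)^{-1/\alpha}\,\|A\varepsilon(0)\|\quad\text{for all } t\ge 0,$$ with $\tilde\beta\geq\beta$.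
   Context: Let $H=\ell^2\times\ell^2$ (complex). Let $\Omega=\mathrm{diag}(\omega_1,\omega_2,\dots)$ with $\omega_j>0$, let $(c_j)_{j\ge1}$ be a real sequence with $\sum_j c_j^2<\infty$, and let $\gamma>0$ be a gain parameter. Define $\check A=-\frac{\gamma}{2}\,(c_jc_\iota)_{j,\iota\ge1}$, i.e. $(\check A q)_j=-\frac{\gamma}{2}c_j\sum_{\iota}c_\iota q_\iota$. The operator $A$ on $H$ acting on $\varepsilon=(q,p)^\top$, $q=(q_1,q_2,\dots)^\top$, $p=(p_1,p_2,\dots)^\top$, is $$A=\begin{pmatrix}-i\Omega+\check A & \check A\\ \check A & i\Omega+\check A\end{pmatrix},$$ with domain $D(A)=\{(q,p)\in H:\sum_j\omega_j^2(|q_j|^2+|p_j|^2)<\infty\}$. The system $\dot\varepsilon=A\varepsilon$ is the observation-error dynamics (in complex coordinates $q_j=\Delta_j+i\delta_j$, $p_j=\Delta_j-i\delta_j$) of a Luenberger-type observer with gain $F=(\gamma c,0)^\top$ for the system $\dot\xi=\Omega\eta$, $\dot\eta=-\Omega\xi+B_1u$ with scalar output $y=\sum_j c_j\xi_j$. *)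

theory Defs
  imports "HOL-Analysis.Analysis"
begin

text \<open>Elements of H = l2 x l2 are pairs (q,p) of complex sequences indexed by nat
  (index 0 corresponds to the paper's index 1).\<close>

type_synonym hvec = "(nat \<Rightarrow> complex) \<times> (nat \<Rightarrow> complex)"

definition ell2 :: "(nat \<Rightarrow> complex) \<Rightarrow> bool" where
  "ell2 x \<longleftrightarrow> summable (\<lambda>j. (cmod (x j))\<^sup>2)"

definition inH :: "hvec \<Rightarrow> bool" where
  "inH v \<longleftrightarrow> ell2 (fst v) \<and> ell2 (snd v)"

definition Hnorm :: "hvec \<Rightarrow> real" where
  "Hnorm v = sqrt ((\<Sum>j. (cmod (fst v j))\<^sup>2) + (\<Sum>j. (cmod (snd v j))\<^sup>2))"

definition Hdiff :: "hvec \<Rightarrow> hvec \<Rightarrow> hvec" where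
  "Hdiff v w = ((\<lambda>j. fst v j - fst w j), (\<lambda>j. snd v j - snd w j))"

definition Hscale :: "real \<Rightarrow> hvec \<Rightarrow> hvec" where
  "Hscale r v = ((\<lambda>j. complex_of_real r * fst v j), (\<lambda>j. complex_of_real r * snd v j))"

definition domA :: "(nat \<Rightarrow> real) \<Rightarrow> hvec \<Rightarrow> bool" where
  "domA \<omega> v \<longleftrightarrow> inH v \<and>
     summable (\<lambda>j. (\<omega> j)\<^sup>2 * ((cmod (fst v j))\<^sup>2 + (cmod (snd v j))\<^sup>2))"

definition Acheck :: "(nat \<Rightarrow> real) \<Rightarrow> real \<Rightarrow> (nat \<Rightarrow> complex) \<Rightarrow> nat \<Rightarrow> complex" where
  "Acheck c \<gamma> q j = - complex_of_real (\<gamma> / 2) * complex_of_real (c j) *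
       (\<Sum>\<iota>. complex_of_real (c \<iota>) * q \<iota>)"

definition Aop :: "(nat \<Rightarrow> real) \<Rightarrow> (nat \<Rightarrow> real) \<Rightarrow> real \<Rightarrow> hvec \<Rightarrow> hvec" where
  "Aop \<omega> c \<gamma> v =
     ((\<lambda>j. - \<i> * complex_of_real (\<omega> j) * fst v j + Acheck c \<gamma> (fst v) j + Acheck c \<gamma> (snd v) j),
      (\<lambda>j. Acheck c \<gamma> (fst v) j + \<i> * complex_of_real (\<omega> j) * snd v j + Acheck c \<gamma> (snd v) j))"

text \<open>Classical solution of eps' = A eps on [0,infinity): eps(t) in D(A) for all t >= 0
  and eps is differentiable in the norm of H (one-sided at t = 0) with derivative A eps(t).\<close>
definition is_solution :: "(nat \<Rightarrow> real) \<Rightarrow> (nat \<Rightarrow> real) \<Rightarrow> real \<Rightarrow> (real \<Rightarrow> hvec) \<Rightarrow> bool" where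
  "is_solution \<omega> c \<gamma> \<epsilon> \<longleftrightarrow>
     (\<forall>t\<ge>0. domA \<omega> (\<epsilon> t)) \<and>
     (\<forall>t\<ge>0. ((\<lambda>h. Hnorm (Hdiff (Hscale (1 / h) (Hdiff (\<epsilon> (t + h)) (\<epsilon> t))) (Aop \<omega> c \<gamma> (\<epsilon> t))))
               \<longlongrightarrow> 0) (at 0 within {h. 0 \<le> t + h}))"

end

theory Submission
  imports Defs
begin

text \<open>
  Interleaving \<open>q\<close> and \<open>p\<close> turns the system into \<open>x\<^sub>n' = i \<mu>\<^sub>n x\<^sub>n - g b\<^sub>n Y\<close> with \<open>Y = \<Sum> b\<^sub>n x\<^sub>n\<close>,
  where the real frequencies \<open>\<mu>\<^sub>n = \<plusminus>\<omega>\<^sub>j\<close> are uniformly separated. The energy \<open>E = \<Sum> |x\<^sub>n|\<^sup>2\<close> satisfies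
  \<open>E' = -2 g |Y|\<^sup>2\<close>. On a time interval of fixed length \<open>T\<close>, Ingham's inequality for the undamped output,
  which differs from \<open>Y\<close> by at most a multiple of \<open>\<integral> |Y|\<close>, gives
  \<open>\<Sum> b\<^sub>n\<^sup>2 |x\<^sub>n(t)|\<^sup>2 \<le> P (E(t) - E(t + T))\<close>. Since \<open>b\<^sub>n\<^sup>2\<close> is at least a multiple of \<open>|\<mu>\<^sub>n|\<close> to the
  power \<open>-\<alpha>\<close>, and \<open>\<Sum> \<mu>\<^sub>n\<^sup>2 |x\<^sub>n(t)|\<^sup>2\<close> is controlled by \<open>\<parallel>A x(t)\<parallel>\<^sup>2 \<le> \<parallel>A x(0)\<parallel>\<^sup>2\<close>, interpolation yields
  \<open>u\<^sub>k\<^sub>+\<^sub>1 \<le> u\<^sub>k - \<eta> (u\<^sub>k powr (1 + \<alpha>/2))\<close> for the normalised energies \<open>u\<^sub>k\<close> at the times \<open>k T\<close>,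
  so that \<open>u\<^sub>k\<close> decays like \<open>k powr (-2/\<alpha>)\<close>.
\<close>

section \<open>Square-summable sequences\<close>

definition l2n :: "(nat \<Rightarrow> complex) \<Rightarrow> real" where
  "l2n a = sqrt (\<Sum>n. (cmod (a n))\<^sup>2)"

lemma l2n_nonneg: "ell2 a \<Longrightarrow> 0 \<le> l2n a"
  by (simp add: l2n_def ell2_def suminf_nonneg)

lemma l2n_squared: "ell2 a \<Longrightarrow> (l2n a)\<^sup>2 = (\<Sum>n. (cmod (a n))\<^sup>2)"
  by (simp add: l2n_def ell2_def suminf_nonneg)

lemma L2_set_le_l2n: "ell2 a \<Longrightarrow> finite F \<Longrightarrow> L2_set (\<lambda>n. cmod (a n)) F \<le> l2n a"
  unfolding L2_set_def l2n_def ell2_def by (intro real_sqrt_le_mono sum_le_suminf) auto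

text \<open>Passage from finite sections to the limit: an \<open>L2_set\<close> bound uniform in
  \<open>N\<close> gives membership and the norm bound together, so the finite-dimensional
  inequalities for \<open>L2_set\<close> carry over.\<close>

lemma ell2_bounded_L2_set:
  assumes "\<And>N. L2_set (\<lambda>n. cmod (a n)) {..<N} \<le> K"
  shows "ell2 a" "l2n a \<le> K"
proof -
  have K: "0 \<le> K" using assms[of 0] by simp
  have le: "(\<Sum>n<N. (cmod (a n))\<^sup>2) \<le> K\<^sup>2" for N
    using assms[of N] K unfolding L2_set_def by (simp add: real_sqrt_le_iff' sqrt_le_D)
  show s: "ell2 a" unfolding ell2_def
    by (rule summableI_nonneg_bounded[where x="K\<^sup>2"]) (use le in auto)
  show "l2n a \<le> K" unfolding l2n_def
    using suminf_le_const[OF s[unfolded ell2_def] le] K by (simp add: real_le_lsqrt)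
qed

lemma
  assumes "ell2 a" "ell2 c"
  shows ell2_add: "ell2 (\<lambda>n. a n + c n)" and l2n_add: "l2n (\<lambda>n. a n + c n) \<le> l2n a + l2n c"
proof -
  have "L2_set (\<lambda>n. cmod (a n + c n)) {..<N} \<le> l2n a + l2n c" for N
  proof -
    have "L2_set (\<lambda>n. cmod (a n + c n)) {..<N} \<le> L2_set (\<lambda>n. cmod (a n) + cmod (c n)) {..<N}"
      by (intro L2_set_mono) (auto simp: norm_triangle_ineq)
    also have "\<dots> \<le> L2_set (\<lambda>n. cmod (a n)) {..<N} + L2_set (\<lambda>n. cmod (c n)) {..<N}"
      by (rule L2_set_triangle_ineq)
    also have "\<dots> \<le> l2n a + l2n c"
      using assms by (intro add_mono L2_set_le_l2n) auto
    finally show ?thesis .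
  qed
  from ell2_bounded_L2_set[OF this]
  show "ell2 (\<lambda>n. a n + c n)" "l2n (\<lambda>n. a n + c n) \<le> l2n a + l2n c" by auto
qed

lemma
  assumes "ell2 a"
  shows ell2_cmult: "ell2 (\<lambda>n. r * a n)" and l2n_cmult: "l2n (\<lambda>n. r * a n) = cmod r * l2n a"
  using assms unfolding ell2_def l2n_def
  by (auto simp: norm_mult power_mult_distrib suminf_mult real_sqrt_mult summable_mult)

lemma ell2_uminus: "ell2 a \<Longrightarrow> ell2 (\<lambda>n. - a n)"
  unfolding ell2_def by simp

lemma l2n_uminus: "l2n (\<lambda>n. - a n) = l2n a"
  unfolding l2n_def by simp

lemma l2n_minus_commute: "l2n (\<lambda>n. a n - c n) = l2n (\<lambda>n. c n - a n)"
  unfolding l2n_def by (simp add: norm_minus_commute)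

lemma ell2_diff: "ell2 a \<Longrightarrow> ell2 c \<Longrightarrow> ell2 (\<lambda>n. a n - c n)"
  using ell2_add[OF _ ell2_uminus, of a c] by simp

lemma l2n_le_add_diff:
  assumes "ell2 a" "ell2 c"
  shows "l2n a \<le> l2n c + l2n (\<lambda>n. a n - c n)"
  using l2n_add[OF assms(2) ell2_diff[OF assms]] by simp

lemma l2n_norm_le:
  assumes "ell2 c" "\<And>n. cmod (a n) \<le> cmod (c n)"
  shows "ell2 a" "l2n a \<le> l2n c"
proof -
  have "L2_set (\<lambda>n. cmod (a n)) {..<N} \<le> l2n c" for N
  proof -
    have "L2_set (\<lambda>n. cmod (a n)) {..<N} \<le> L2_set (\<lambda>n. cmod (c n)) {..<N}"
      by (intro L2_set_mono) (auto simp: assms)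
    with L2_set_le_l2n[OF assms(1), of "{..<N}"] show ?thesis by simp
  qed
  from ell2_bounded_L2_set[OF this] show "ell2 a" "l2n a \<le> l2n c" by auto
qed

lemma norm_le_l2n: "ell2 a \<Longrightarrow> cmod (a n) \<le> l2n a"
  using L2_set_le_l2n[of a "{n}"] by (simp add: L2_set_def)

lemma l2n_Cauchy_Schwarz:
  assumes "ell2 a" "ell2 c"
  shows "summable (\<lambda>n. cmod (a n * c n))" "cmod (\<Sum>n. a n * c n) \<le> l2n a * l2n c"
proof -
  have le: "(\<Sum>n<N. cmod (a n * c n)) \<le> l2n a * l2n c" for N
  proof -
    have "(\<Sum>n<N. cmod (a n * c n)) = (\<Sum>n<N. \<bar>cmod (a n)\<bar> * \<bar>cmod (c n)\<bar>)"
      by (simp add: norm_mult)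
    also have "\<dots> \<le> L2_set (\<lambda>n. cmod (a n)) {..<N} * L2_set (\<lambda>n. cmod (c n)) {..<N}"
      by (rule L2_set_mult_ineq)
    also have "\<dots> \<le> l2n a * l2n c"
      using assms by (intro mult_mono L2_set_le_l2n) (auto simp: L2_set_nonneg l2n_nonneg)
    finally show ?thesis .
  qed
  show s: "summable (\<lambda>n. cmod (a n * c n))"
    by (rule summableI_nonneg_bounded[where x="l2n a * l2n c"]) (use le in auto)
  have "cmod (\<Sum>n. a n * c n) \<le> (\<Sum>n. cmod (a n * c n))" by (rule summable_norm[OF s])
  also have "\<dots> \<le> l2n a * l2n c" by (rule suminf_le_const[OF s le])
  finally show "cmod (\<Sum>n. a n * c n) \<le> l2n a * l2n c" .
qed

section \<open>Sums of inverse squares over separated points\<close>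

text \<open>Telescoping: \<open>1 / (n+1)^2 \<le> 1 / n - 1 / (n+1)\<close>. The induction carries
  the sharper bound \<open>2 - 1 / N\<close>.\<close>

lemma sum_inverse_squares_le:
  assumes "finite K" "\<And>k. k \<in> K \<Longrightarrow> k > (0::nat)"
  shows "(\<Sum>k\<in>K. 1 / (real k)\<^sup>2) \<le> 2"
proof -
  have *: "(\<Sum>k=1..N. 1 / (real k)\<^sup>2) \<le> 2 - 1 / real N" if "N > 0" for N
    using that
  proof (induction N rule: nat_induct_non_zero)
    case (Suc n)
    have "1 / (real (Suc n))\<^sup>2 \<le> 1 / real n - 1 / real (Suc n)"
      using Suc.hyps by (simp add: divide_simps power2_eq_square)
    then show ?case using Suc.IH by simp
  qed simp
  have "(\<Sum>k\<in>K. 1 / (real k)\<^sup>2) \<le> (\<Sum>k=1..Suc (Max (insert 0 K)). 1 / (real k)\<^sup>2)"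
  proof (rule sum_mono2)
    show "K \<subseteq> {1..Suc (Max (insert 0 K))}"
      using assms by (auto simp: Suc_le_eq le_Suc_eq intro!: le_SucI)
  qed auto
  also have "\<dots> \<le> 2" using *[of "Suc (Max (insert 0 K))"]
    by (smt (verit) divide_nonneg_nonneg of_nat_0_le_iff zero_less_Suc)
  finally show ?thesis .
qed

lemma sum_inverse_squares_int_le:
  assumes "finite K" "0 \<notin> K"
  shows "(\<Sum>k\<in>K. 1 / (real_of_int k)\<^sup>2) \<le> 4"
proof -
  have K: "K = {k\<in>K. k > 0} \<union> {k\<in>K. k < 0}" using assms by (auto simp: not_less_iff_gr_or_eq)
  have 1: "(\<Sum>k\<in>{k\<in>K. k > 0}. 1 / (real_of_int k)\<^sup>2) \<le> 2"
  proof -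
    have "(\<Sum>k\<in>{k\<in>K. k > 0}. 1 / (real_of_int k)\<^sup>2) = (\<Sum>k\<in>nat ` {k\<in>K. k > 0}. 1 / (real k)\<^sup>2)"
      by (subst sum.reindex) (auto simp: inj_on_def)
    also have "\<dots> \<le> 2" using assms by (intro sum_inverse_squares_le) auto
    finally show ?thesis .
  qed
  have 2: "(\<Sum>k\<in>{k\<in>K. k < 0}. 1 / (real_of_int k)\<^sup>2) \<le> 2"
  proof -
    have "(\<Sum>k\<in>{k\<in>K. k < 0}. 1 / (real_of_int k)\<^sup>2) = (\<Sum>k\<in>(nat \<circ> uminus) ` {k\<in>K. k < 0}. 1 / (real k)\<^sup>2)"
      by (subst sum.reindex) (auto simp: inj_on_def)
    also have "\<dots> \<le> 2" using assms by (intro sum_inverse_squares_le) auto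
    finally show ?thesis .
  qed
  have "(\<Sum>k\<in>K. 1 / (real_of_int k)\<^sup>2) = (\<Sum>k\<in>{k\<in>K. k > 0}. 1 / (real_of_int k)\<^sup>2) + (\<Sum>k\<in>{k\<in>K. k < 0}. 1 / (real_of_int k)\<^sup>2)"
    by (subst K, rule sum.union_disjoint) (use assms in auto)
  with 1 2 show ?thesis by simp
qed

text \<open>For fixed \<open>n\<close> the integers \<open>z m - z n\<close> with
  \<open>m \<noteq> n\<close> are distinct and nonzero, so the sum is dominated by one over nonzero
  integers. The bound is independent of \<open>F\<close> and \<open>n\<close>, as a row-sum estimate
  requires.\<close>

lemma sum_inverse_square_gaps_le:
  fixes \<mu> :: "'a \<Rightarrow> real" and z :: "'a \<Rightarrow> int"
  assumes "finite F" "inj z" "\<delta> > 0"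
    and gap: "\<And>m n. \<delta> * \<bar>real_of_int (z m - z n)\<bar> \<le> \<bar>\<mu> m - \<mu> n\<bar>"
  shows "(\<Sum>m\<in>F-{n}. 1 / (\<mu> m - \<mu> n)\<^sup>2) \<le> 4 / \<delta>\<^sup>2"
proof -
  have "(\<Sum>m\<in>F-{n}. 1 / (\<mu> m - \<mu> n)\<^sup>2) \<le> (\<Sum>m\<in>F-{n}. 1 / \<delta>\<^sup>2 * (1 / (real_of_int (z m - z n))\<^sup>2))"
  proof (rule sum_mono)
    fix m assume m: "m \<in> F - {n}"
    have "z m \<noteq> z n" using m \<open>inj z\<close> by (auto dest: injD)
    then have p: "0 < (\<delta> * \<bar>real_of_int (z m - z n)\<bar>)\<^sup>2" using \<open>\<delta> > 0\<close> by auto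
    have "(\<delta> * \<bar>real_of_int (z m - z n)\<bar>)\<^sup>2 \<le> \<bar>\<mu> m - \<mu> n\<bar>\<^sup>2"
      using gap[of m n] \<open>\<delta> > 0\<close> by (intro power_mono) auto
    then have "1 / (\<mu> m - \<mu> n)\<^sup>2 \<le> 1 / (\<delta> * \<bar>real_of_int (z m - z n)\<bar>)\<^sup>2"
      using p by (intro divide_left_mono mult_pos_pos) auto
    then show "1 / (\<mu> m - \<mu> n)\<^sup>2 \<le> 1 / \<delta>\<^sup>2 * (1 / (real_of_int (z m - z n))\<^sup>2)"
      by (simp add: power_mult_distrib)
  qed
  also have "\<dots> = 1 / \<delta>\<^sup>2 * (\<Sum>k\<in>(\<lambda>m. z m - z n) ` (F-{n}). 1 / (real_of_int k)\<^sup>2)"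
    by (subst sum.reindex) (use \<open>inj z\<close> in \<open>auto simp: inj_on_def sum_distrib_left inj_def\<close>)
  also have "\<dots> \<le> 1 / \<delta>\<^sup>2 * 4"
    using assms(1) \<open>inj z\<close> by (intro mult_left_mono sum_inverse_squares_int_le) (auto dest: injD)
  finally show ?thesis by simp
qed

section \<open>Ingham's inequality\<close>

text \<open>The weight vanishes at both endpoints, so integration by parts leaves no boundary term
  of order \<open>1 / \<xi>\<close> and the decay is quadratic.\<close>

lemma parabola_fourier:
  fixes \<xi> T :: real
  assumes "\<xi> \<noteq> 0" "T \<ge> 0"
  obtains I where "((\<lambda>t. of_real (t * (T - t)) * cis (\<xi> * t)) has_integral I) {0..T}"
    "cmod I \<le> 2 * T / \<xi>\<^sup>2 + 4 / \<bar>\<xi>\<bar> ^ 3"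
proof -
  define k where "k = \<i> * complex_of_real \<xi>"
  have k: "k \<noteq> 0" using assms by (simp add: k_def)
  have nk: "cmod k = \<bar>\<xi>\<bar>" by (simp add: k_def norm_mult)
  \<comment> \<open>Repeated integration by parts gives this antiderivative: the exponential times
    \<open>p / k - p' / k^2 + p'' / k^3\<close> with \<open>p = z * (T - z)\<close>.\<close>
  define f where "f z = exp (k * z) * (z * (of_real T - z) / k - (of_real T - 2 * z) / k^2 - 2 / k^3)" for z
  have D: "(f has_field_derivative (z * (of_real T - z) * exp (k * z))) (at z)" for z
    unfolding f_def using k
    by (auto intro!: derivative_eq_intros simp: field_simps eval_nat_numeral)
  have "((\<lambda>t. f (of_real t)) has_vector_derivative (of_real t * (of_real T - of_real t) * exp (k * of_real t)))
     (at t within {0..T})" for t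
    by (rule has_vector_derivative_real_field) (rule D)
  then have I: "((\<lambda>t. of_real t * (of_real T - of_real t) * exp (k * of_real t)) has_integral (f (of_real T) - f (of_real 0))) {0..T}"
    using assms by (intro fundamental_theorem_of_calculus) auto
  have eq: "of_real t * (of_real T - of_real t) * exp (k * of_real t) = of_real (t * (T - t)) * cis (\<xi> * t)" for t
    by (simp add: k_def cis_conv_exp mult.assoc)
  have nexp: "cmod (exp (k * of_real T)) = 1" by (simp add: k_def)
  have "f (of_real T) - f (of_real 0) = exp (k * of_real T) * (of_real T / k^2 - 2 / k^3) + (of_real T / k^2 + 2 / k^3)"
    by (simp add: f_def)
  also have "cmod \<dots> \<le> cmod (exp (k * of_real T) * (of_real T / k^2 - 2 / k^3)) + cmod (of_real T / k^2 + 2 / k^3)"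
    by (rule norm_triangle_ineq)
  also have "\<dots> = cmod (of_real T / k^2 - 2 / k^3) + cmod (of_real T / k^2 + 2 / k^3)"
    by (simp only: norm_mult nexp mult_1)
  also have "\<dots> \<le> (cmod (of_real T / k^2) + cmod (2 / k^3)) + (cmod (of_real T / k^2) + cmod (2 / k^3))"
    by (intro add_mono norm_triangle_ineq norm_triangle_ineq4)
  also have "\<dots> = 2 * T / \<xi>\<^sup>2 + 4 / \<bar>\<xi>\<bar> ^ 3"
    using assms by (simp add: norm_divide norm_power nk)
  finally show ?thesis using I that unfolding eq by blast
qed

lemma parabola_integral:
  "T \<ge> 0 \<Longrightarrow> ((\<lambda>t. complex_of_real (t * (T - t))) has_integral of_real (T^3/6)) {0..T}"
proof -
  assume T: "T \<ge> 0"
  have "((\<lambda>t. t * (T - t)) has_integral ((T * T^2/2 - T^3/3) - (T * 0^2/2 - 0^3/3))) {0..T}"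
    using T by (intro fundamental_theorem_of_calculus)
      (auto intro!: derivative_eq_intros simp: has_real_derivative_iff_has_vector_derivative[symmetric] power2_eq_square algebra_simps)
  then have "((\<lambda>t. t * (T - t)) has_integral (T^3/6)) {0..T}"
    by (simp add: power2_eq_square power3_eq_cube mult.assoc)
  then show ?thesis by (rule has_integral_of_real)
qed

text \<open>Against the weight \<open>t (T - t)\<close> the exponentials are almost orthogonal: their Gram entries decay like
  the inverse square of the frequency gap.\<close>
lemma Ingham_inequality:
  fixes \<mu> :: "'a \<Rightarrow> real" and z :: "'a \<Rightarrow> int" and a :: "'a \<Rightarrow> complex"
  assumes F: "finite F" and "inj z" and d: "\<delta> > 0"
    and gap: "\<And>m n. \<delta> * \<bar>real_of_int (z m - z n)\<bar> \<le> \<bar>\<mu> m - \<mu> n\<bar>"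
    and T: "T = 12 / \<delta>"
  shows "(\<Sum>n\<in>F. (cmod (a n))\<^sup>2) \<le> 3 / T * integral {0..T} (\<lambda>t. (cmod (\<Sum>n\<in>F. a n * cis (\<mu> n * t)))\<^sup>2)"
proof -
  have T0: "T > 0" using d T by simp
  define S where "S = (\<Sum>n\<in>F. (cmod (a n))\<^sup>2)"
  define h where "h t = (\<Sum>n\<in>F. a n * cis (\<mu> n * t))" for t
  define w where "w m n = (if m = n then 0 else 1 / (\<mu> m - \<mu> n)\<^sup>2)" for m n
  \<comment> \<open>\<open>2 * T\<close> is the quadratic term of \<open>parabola_fourier\<close>;
    \<open>4 / \<delta>\<close> comes from its cubic term, one factor
    \<open>1 / \<bar>\<xi>\<bar>\<close> being bounded by \<open>1 / \<delta>\<close>.\<close>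
  define c where "c = 2 * T + 4 / \<delta>"
  have c0: "c > 0" using T0 d by (simp add: c_def add_pos_pos)
  have sep: "\<bar>\<mu> m - \<mu> n\<bar> \<ge> \<delta>" if "m \<noteq> n" for m n
  proof -
    have "z m \<noteq> z n" using that \<open>inj z\<close> by (auto dest: injD)
    then have "1 \<le> \<bar>real_of_int (z m - z n)\<bar>" by linarith
    then have "\<delta> * 1 \<le> \<delta> * \<bar>real_of_int (z m - z n)\<bar>" using d by (intro mult_left_mono) auto
    with gap[of m n] show ?thesis by simp
  qed
  have ex: "\<exists>I. ((\<lambda>t. of_real (t * (T - t)) * cis ((\<mu> m - \<mu> n) * t)) has_integral I) {0..T} \<and>
        (m = n \<longrightarrow> I = of_real (T^3/6)) \<and> (m \<noteq> n \<longrightarrow> cmod I \<le> c * w m n)" for m n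
  proof (cases "m = n")
    case True
    then show ?thesis using parabola_integral[of T] T0 by auto
  next
    case False
    let ?x = "\<mu> m - \<mu> n"
    have x: "\<bar>?x\<bar> \<ge> \<delta>" using sep False by blast
    then have x0: "?x \<noteq> 0" "\<bar>?x\<bar> > 0" using d by auto
    obtain I where I: "((\<lambda>t. of_real (t * (T - t)) * cis (?x * t)) has_integral I) {0..T}"
      "cmod I \<le> 2 * T / ?x\<^sup>2 + 4 / \<bar>?x\<bar> ^ 3" using parabola_fourier[OF x0(1), of T] T0 by auto
    have "4 / \<bar>?x\<bar> ^ 3 = 4 / \<bar>?x\<bar> * (1 / ?x\<^sup>2)" by (simp add: power3_eq_cube power2_eq_square)
    also have "\<dots> \<le> 4 / \<delta> * (1 / ?x\<^sup>2)" using x d x0 by (intro mult_right_mono divide_left_mono mult_pos_pos) auto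
    finally have "cmod I \<le> c * w m n" using I(2) False by (simp add: c_def w_def algebra_simps)
    then show ?thesis using I(1) False by blast
  qed
  define \<Phi> where "\<Phi> m n = integral {0..T} (\<lambda>t. of_real (t * (T - t)) * cis ((\<mu> m - \<mu> n) * t))" for m n
  have Phi: "((\<lambda>t. of_real (t * (T - t)) * cis ((\<mu> m - \<mu> n) * t)) has_integral \<Phi> m n) {0..T}"
      "\<Phi> n n = of_real (T^3/6)" "m \<noteq> n \<Longrightarrow> cmod (\<Phi> m n) \<le> c * w m n" for m n
    using ex[of m n] ex[of n n] unfolding \<Phi>_def by (auto simp only: integral_unique)
  \<comment> \<open>\<open>V\<close> is the Gram form of the exponentials and equals the weighted
    integral of the squared modulus of \<open>h\<close>. It is bounded above through the weight and
    below through diagonal dominance.\<close>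
  define V where "V = (\<Sum>m\<in>F. \<Sum>n\<in>F. a m * cnj (a n) * \<Phi> m n)"
  have "((\<lambda>t. \<Sum>m\<in>F. \<Sum>n\<in>F. a m * cnj (a n) * (of_real (t * (T - t)) * cis ((\<mu> m - \<mu> n) * t))) has_integral V) {0..T}"
    unfolding V_def by (intro has_integral_sum F has_integral_mult_right Phi)
  moreover have "(\<Sum>m\<in>F. \<Sum>n\<in>F. a m * cnj (a n) * (of_real (t * (T - t)) * cis ((\<mu> m - \<mu> n) * t)))
      = of_real (t * (T - t) * (cmod (h t))\<^sup>2)" for t
  proof -
    have "of_real (t * (T - t) * (cmod (h t))\<^sup>2) = of_real (t * (T - t)) * (h t * cnj (h t))"
      by (simp only: of_real_mult complex_norm_square)
    also have "h t * cnj (h t) = (\<Sum>m\<in>F. \<Sum>n\<in>F. (a m * cis (\<mu> m * t)) * cnj (a n * cis (\<mu> n * t)))"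
      by (simp add: h_def sum_product)
    also have "of_real (t * (T - t)) * \<dots> = (\<Sum>m\<in>F. \<Sum>n\<in>F. a m * cnj (a n) * (of_real (t * (T - t)) * cis ((\<mu> m - \<mu> n) * t)))"
      unfolding sum_distrib_left
    proof (intro sum.cong refl)
      fix m n
      have "cis ((\<mu> m - \<mu> n) * t) = cis (\<mu> m * t) * cnj (cis (\<mu> n * t))"
        by (simp add: cis_cnj cis_mult algebra_simps)
      then show "of_real (t * (T - t)) * (a m * cis (\<mu> m * t) * cnj (a n * cis (\<mu> n * t))) =
         a m * cnj (a n) * (of_real (t * (T - t)) * cis ((\<mu> m - \<mu> n) * t))" by simp
    qed
    finally show ?thesis by simp
  qed
  ultimately have "((\<lambda>t. complex_of_real (t * (T - t) * (cmod (h t))\<^sup>2)) has_integral V) {0..T}" by simp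
  from has_integral_Re[OF this]
  have VI: "((\<lambda>t. t * (T - t) * (cmod (h t))\<^sup>2) has_integral Re V) {0..T}" by simp
  have hc: "continuous_on {0..T} (\<lambda>t. (cmod (h t))\<^sup>2)"
    unfolding h_def by (intro continuous_intros)
  then have hi: "((\<lambda>t. (cmod (h t))\<^sup>2) has_integral integral {0..T} (\<lambda>t. (cmod (h t))\<^sup>2)) {0..T}"
    by (intro integrable_integral integrable_continuous_real)
  have upper: "Re V \<le> T\<^sup>2/4 * integral {0..T} (\<lambda>t. (cmod (h t))\<^sup>2)"
  proof (rule has_integral_le[OF VI has_integral_mult_right[OF hi]])
    fix t
    have "0 \<le> (t - T/2)\<^sup>2" by simp
    then have "t * (T - t) \<le> T\<^sup>2/4" by (simp add: power2_eq_square algebra_simps)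
    then show "t * (T - t) * (cmod (h t))\<^sup>2 \<le> T\<^sup>2/4 * (cmod (h t))\<^sup>2" by (intro mult_right_mono) auto
  qed
  have wsym: "w m n = w n m" for m n by (simp add: w_def power2_commute)
  have wpos: "0 \<le> w m n" for m n by (simp add: w_def)
  have wsum: "(\<Sum>m\<in>F. w m n) \<le> 4 / \<delta>\<^sup>2" if "n \<in> F" for n
  proof -
    have "(\<Sum>m\<in>F. w m n) = (\<Sum>m\<in>F-{n}. w m n)"
      using that F by (subst sum.remove[of F n]) (auto simp: w_def)
    also have "\<dots> = (\<Sum>m\<in>F-{n}. 1 / (\<mu> m - \<mu> n)\<^sup>2)" by (rule sum.cong) (auto simp: w_def)
    also have "\<dots> \<le> 4 / \<delta>\<^sup>2" by (rule sum_inverse_square_gaps_le[OF F \<open>inj z\<close> d gap])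
    finally show ?thesis .
  qed
  define A where "A n = (cmod (a n))\<^sup>2" for n
  \<comment> \<open>The arithmetic-geometric mean inequality splits
    \<open>cmod (a m) * cmod (a n)\<close> into squares; as \<open>w\<close> is symmetric, only its
    row sums then matter (Schur's test).\<close>
  have entry: "(if m = n then T^3/6 * A n else 0) - c * ((A m + A n)/2 * w m n) \<le> Re (a m * cnj (a n) * \<Phi> m n)" for m n
  proof (cases "m = n")
    case True
    have "a n * cnj (a n) * \<Phi> n n = of_real (A n * (T^3/6))"
      by (simp only: Phi A_def of_real_mult complex_norm_square)
    then have "Re (a n * cnj (a n) * \<Phi> n n) = A n * (T^3/6)" by (simp only: Re_complex_of_real)
    then show ?thesis using True by (simp add: w_def mult.commute)
  next
    case False
    have "cmod (a m * cnj (a n) * \<Phi> m n) = cmod (a m) * cmod (a n) * cmod (\<Phi> m n)" by (simp add: norm_mult)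
    also have "\<dots> \<le> ((A m + A n)/2) * (c * w m n)"
    proof (intro mult_mono Phi(3) False)
      have "0 \<le> (cmod (a m) - cmod (a n))\<^sup>2" by simp
      then show "cmod (a m) * cmod (a n) \<le> (A m + A n)/2" unfolding A_def power2_diff by simp
    qed (auto simp: A_def)
    finally have "\<bar>Re (a m * cnj (a n) * \<Phi> m n)\<bar> \<le> c * ((A m + A n)/2 * w m n)"
      using abs_Re_le_cmod[of "a m * cnj (a n) * \<Phi> m n"] by (simp only: mult_ac order_trans)
    with False show ?thesis by (simp only: if_False abs_le_iff) linarith
  qed
  have "(\<Sum>m\<in>F. \<Sum>n\<in>F. (if m = n then T^3/6 * A n else 0) - c * ((A m + A n)/2 * w m n)) \<le> Re V"
    unfolding V_def Re_sum by (intro sum_mono entry)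
  moreover have "(\<Sum>m\<in>F. \<Sum>n\<in>F. (if m = n then T^3/6 * A n else 0) - c * ((A m + A n)/2 * w m n))
      = T^3/6 * S - c * (\<Sum>m\<in>F. \<Sum>n\<in>F. (A m + A n)/2 * w m n)"
    using F by (simp add: sum_subtractf sum.delta sum_distrib_left S_def A_def)
  moreover have "(\<Sum>m\<in>F. \<Sum>n\<in>F. (A m + A n)/2 * w m n) \<le> 4 / \<delta>\<^sup>2 * S"
  proof -
    have "(\<Sum>m\<in>F. \<Sum>n\<in>F. (A m + A n)/2 * w m n) = (\<Sum>m\<in>F. \<Sum>n\<in>F. A m/2 * w m n) + (\<Sum>m\<in>F. \<Sum>n\<in>F. A n/2 * w m n)"
      by (simp add: sum.distrib add_divide_distrib distrib_right)
    also have "(\<Sum>m\<in>F. \<Sum>n\<in>F. A m/2 * w m n) = (\<Sum>m\<in>F. \<Sum>n\<in>F. A n/2 * w m n)"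
      by (subst sum.swap) (simp add: wsym)
    also have "(\<Sum>m\<in>F. \<Sum>n\<in>F. A n/2 * w m n) + (\<Sum>m\<in>F. \<Sum>n\<in>F. A n/2 * w m n) = (\<Sum>n\<in>F. A n * (\<Sum>m\<in>F. w m n))"
      by (subst (1 2) sum.swap) (simp add: sum_distrib_left sum_divide_distrib[symmetric])
    also have "\<dots> \<le> (\<Sum>n\<in>F. A n * (4 / \<delta>\<^sup>2))"
      by (intro sum_mono mult_left_mono wsum) (auto simp: A_def)
    also have "\<dots> = 4 / \<delta>\<^sup>2 * S" by (simp only: S_def A_def sum_distrib_right mult.commute[of _ "4 / \<delta>\<^sup>2"] sum_distrib_left)
    finally show ?thesis .
  qed
  then have "c * (\<Sum>m\<in>F. \<Sum>n\<in>F. (A m + A n)/2 * w m n) \<le> c * (4 / \<delta>\<^sup>2 * S)"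
    using c0 by (intro mult_left_mono) auto
  ultimately have lower: "T^3/6 * S - c * (4 / \<delta>\<^sup>2 * S) \<le> Re V" by linarith
  have S0: "0 \<le> S" by (simp add: S_def sum_nonneg)
  have dT: "\<delta> = 12 / T" using T d by simp
  \<comment> \<open>The length \<open>T = 12 / \<delta>\<close> is chosen for this:
    \<open>c = 7 * T / 3\<close> and \<open>4 / \<delta>^2 = T^2 / 36\<close>, so the off-diagonal
    part is at most \<open>7/108 * T^3 * S\<close>, less than half of the diagonal part
    \<open>T^3 / 6 * S\<close>.\<close>
  have "c * (4 / \<delta>\<^sup>2) = T^3 * (7/108)"
    using T0 by (simp add: c_def dT power2_eq_square power3_eq_cube)
  then have "c * (4 / \<delta>\<^sup>2 * S) = T^3 * (7/108) * S" by (metis mult.assoc)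
  moreover have "T^3 * (7/108) * S \<le> T^3 * (1/12) * S" using T0 S0 by (intro mult_right_mono mult_left_mono) auto
  ultimately have "T^3/12 * S \<le> T\<^sup>2/4 * integral {0..T} (\<lambda>t. (cmod (h t))\<^sup>2)"
    using lower upper by (simp add: algebra_simps)
  then have "T\<^sup>2/4 * (T/3 * S) \<le> T\<^sup>2/4 * integral {0..T} (\<lambda>t. (cmod (h t))\<^sup>2)"
    by (simp add: power2_eq_square power3_eq_cube algebra_simps)
  then have "T/3 * S \<le> integral {0..T} (\<lambda>t. (cmod (h t))\<^sup>2)"
    using T0 by (subst (asm) mult_le_cancel_left_pos) auto
  then have "S \<le> 3 / T * integral {0..T} (\<lambda>t. (cmod (h t))\<^sup>2)"
    using T0 by (simp add: field_simps)
  then show ?thesis unfolding S_def h_def .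
qed

section \<open>Diagonal systems with rank-one damping\<close>

locale rank_one_damping =
  fixes \<mu> b :: "nat \<Rightarrow> real" and g :: real
  assumes g_pos: "g > 0" and b_l2: "summable (\<lambda>n. (b n)\<^sup>2)"
begin

definition out :: "(nat \<Rightarrow> complex) \<Rightarrow> complex" where
  "out x = (\<Sum>n. of_real (b n) * x n)"

text \<open>A skew-adjoint diagonal operator with collocated feedback: damping acts through the same
  vector \<open>b\<close> that is observed, which makes it dissipative.\<close>

definition gen :: "(nat \<Rightarrow> complex) \<Rightarrow> nat \<Rightarrow> complex" where
  "gen x n = \<i> * of_real (\<mu> n) * x n - of_real (g * b n) * out x"

definition bsq :: real where
  "bsq = (\<Sum>n. (b n)\<^sup>2)"

text \<open>Difference quotients converge in the \<open>ell2\<close> norm;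
  \<open>at t within {0..}\<close> makes the derivative one-sided at 0. The condition on
  \<open>\<mu> n * X t n\<close> is membership in the domain of the diagonal part.\<close>

definition sol :: "(real \<Rightarrow> nat \<Rightarrow> complex) \<Rightarrow> bool" where
  "sol X \<longleftrightarrow> (\<forall>t\<ge>0. ell2 (X t) \<and> ell2 (\<lambda>n. of_real (\<mu> n) * X t n) \<and>
     ((\<lambda>s. l2n (\<lambda>n. (X s n - X t n) / of_real (s - t) - gen (X t) n)) \<longlongrightarrow> 0) (at t within {0..}))"

lemma ell2_b: "ell2 (\<lambda>n. of_real (b n))"
  using b_l2 by (simp add: ell2_def)

lemma bsq_nonneg: "0 \<le> bsq"
  unfolding bsq_def using b_l2 by (rule suminf_nonneg) auto

lemma l2n_b: "l2n (\<lambda>n. of_real (b n)) = sqrt bsq"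
  by (simp add: l2n_def bsq_def)

lemma summable_out: "ell2 x \<Longrightarrow> summable (\<lambda>n. of_real (b n) * x n)"
  using l2n_Cauchy_Schwarz(1)[OF ell2_b] by (rule summable_norm_cancel)

lemma norm_out_le: "ell2 x \<Longrightarrow> cmod (out x) \<le> sqrt bsq * l2n x"
  unfolding out_def using l2n_Cauchy_Schwarz(2)[OF ell2_b] by (simp add: l2n_b)

lemma out_diff: "ell2 x \<Longrightarrow> ell2 y \<Longrightarrow> out (\<lambda>n. x n - y n) = out x - out y"
  unfolding out_def by (simp add: suminf_diff[OF summable_out summable_out] right_diff_distrib)

lemma gen_diff: "ell2 x \<Longrightarrow> ell2 y \<Longrightarrow> gen (\<lambda>n. x n - y n) n = gen x n - gen y n"
  unfolding gen_def by (simp add: out_diff algebra_simps)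

lemma ell2_gen:
  assumes "ell2 (\<lambda>n. of_real (\<mu> n) * x n)"
  shows "ell2 (gen x)"
proof -
  have "ell2 (\<lambda>n. \<i> * (of_real (\<mu> n) * x n) - (of_real g * out x) * of_real (b n))"
    by (intro ell2_diff ell2_cmult assms ell2_b)
  then show ?thesis by (simp add: gen_def[abs_def] mult_ac)
qed

text \<open>The \<open>ell2\<close> norm of \<open>b\<close> with its first \<open>N\<close> entries
  removed, written so that convergence to 0 is immediate.\<close>

definition tail :: "nat \<Rightarrow> real" where
  "tail N = sqrt (bsq - (\<Sum>n<N. (b n)\<^sup>2))"

lemma tail_tendsto: "tail \<longlonglongrightarrow> 0"
proof -
  have "(\<lambda>N. sqrt (bsq - (\<Sum>n<N. (b n)\<^sup>2))) \<longlonglongrightarrow> sqrt (bsq - bsq)"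
    unfolding bsq_def by (intro tendsto_intros summable_LIMSEQ b_l2)
  then show ?thesis by (simp add: tail_def[abs_def])
qed

lemma tail_nonneg: "0 \<le> tail N"
  unfolding tail_def bsq_def using sum_le_suminf[OF b_l2, of "{..<N}"] by simp

text \<open>Cauchy-Schwarz against \<open>b\<close> with its first \<open>N\<close> entries set to
  0. The error is uniform on norm-bounded sets of states, which later replaces interchanging the
  infinite sum with a time integral.\<close>

lemma out_truncate:
  assumes "ell2 x"
  shows "cmod (out x - (\<Sum>n<N. of_real (b n) * x n)) \<le> tail N * l2n x"
proof -
  define b' :: "nat \<Rightarrow> complex" where "b' n = (if n < N then 0 else of_real (b n))" for n
  have b': "ell2 b'" by (rule l2n_norm_le[OF ell2_b]) (simp add: b'_def)
  have s1: "(\<lambda>n. of_real (b n) * x n) sums out x"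
    unfolding out_def by (rule summable_sums[OF summable_out[OF assms]])
  have "(\<lambda>n. if n \<in> {..<N} then of_real (b n) * x n else 0) sums (\<Sum>n<N. of_real (b n) * x n)"
    by (rule sums_If_finite_set) simp
  from sums_diff[OF s1 this]
  have "(\<lambda>n. b' n * x n) sums (out x - (\<Sum>n<N. of_real (b n) * x n))"
    by (rule back_subst[where P="\<lambda>f. f sums _"]) (auto simp: b'_def fun_eq_iff)
  then have eq: "(\<Sum>n. b' n * x n) = out x - (\<Sum>n<N. of_real (b n) * x n)"
    by (simp add: sums_iff)
  have s2: "(\<lambda>n. (b n)\<^sup>2) sums bsq" unfolding bsq_def by (rule summable_sums[OF b_l2])
  have "(\<lambda>n. if n \<in> {..<N} then (b n)\<^sup>2 else 0) sums (\<Sum>n<N. (b n)\<^sup>2)"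
    by (rule sums_If_finite_set) simp
  from sums_diff[OF s2 this]
  have "(\<lambda>n. (cmod (b' n))\<^sup>2) sums (bsq - (\<Sum>n<N. (b n)\<^sup>2))"
    by (rule back_subst[where P="\<lambda>f. f sums _"]) (auto simp: b'_def fun_eq_iff)
  then have "l2n b' = tail N"
    by (simp add: l2n_def tail_def sums_iff)
  then show ?thesis using l2n_Cauchy_Schwarz(2)[OF b' assms] by (simp add: eq)
qed

section \<open>Regularity, autonomy and linearity of solutions\<close>

lemma
  assumes "sol X" "t \<ge> 0"
  shows sol_ell2: "ell2 (X t)" and sol_ell2_mu: "ell2 (\<lambda>n. of_real (\<mu> n) * X t n)"
    and sol_ell2_gen: "ell2 (gen (X t))"
    and sol_tendsto: "((\<lambda>s. l2n (\<lambda>n. (X s n - X t n) / of_real (s - t) - gen (X t) n)) \<longlongrightarrow> 0) (at t within {0..})"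
  using assms ell2_gen unfolding sol_def by auto

lemma sol_ell2_quotient:
  assumes "sol X" "t \<ge> 0" "s \<ge> 0"
  shows "ell2 (\<lambda>n. (X s n - X t n) / of_real (s - t))"
  using ell2_cmult[OF ell2_diff[OF sol_ell2[OF assms(1,3)] sol_ell2[OF assms(1,2)]], of "1 / of_real (s - t)"]
  by simp

text \<open>The increment is \<open>s - t\<close> times a difference quotient whose norm exceeds
  that of \<open>gen (X t)\<close> by at most a vanishing term.\<close>

lemma sol_norm_continuous:
  assumes X: "sol X" "t \<ge> 0"
  shows "((\<lambda>s. l2n (\<lambda>n. X s n - X t n)) \<longlongrightarrow> 0) (at t within {0..})"
proof -
  let ?D = "\<lambda>s. l2n (\<lambda>n. (X s n - X t n) / of_real (s - t) - gen (X t) n)"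
  have "((\<lambda>s. \<bar>s - t\<bar> * (?D s + l2n (gen (X t)))) \<longlongrightarrow> \<bar>t - t\<bar> * (0 + l2n (gen (X t)))) (at t within {0..})"
    by (intro tendsto_intros sol_tendsto X)
  then have lim: "((\<lambda>s. \<bar>s - t\<bar> * (?D s + l2n (gen (X t)))) \<longlongrightarrow> 0) (at t within {0..})" by simp
  show ?thesis
  proof (rule Lim_null_comparison[OF _ lim])
    show "\<forall>\<^sub>F s in at t within {0..}. norm (l2n (\<lambda>n. X s n - X t n)) \<le> \<bar>s - t\<bar> * (?D s + l2n (gen (X t)))"
      unfolding eventually_at_filter
    proof (intro always_eventually allI impI)
      fix s assume s: "s \<noteq> t" "s \<in> {0..}"
      then have s0: "s \<ge> 0" by simp
      let ?Q = "\<lambda>n. (X s n - X t n) / of_real (s - t)"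
      have Q: "ell2 ?Q" by (rule sol_ell2_quotient[OF X s0])
      have "l2n ?Q \<le> l2n (gen (X t)) + ?D s"
        by (rule l2n_le_add_diff[OF Q sol_ell2_gen[OF X]])
      moreover have "l2n (\<lambda>n. X s n - X t n) = \<bar>s - t\<bar> * l2n ?Q"
      proof -
        have "(\<lambda>n. X s n - X t n) = (\<lambda>n. of_real (s - t) * ?Q n)" using s by (auto simp flip: of_real_diff)
        then show ?thesis using l2n_cmult[OF Q, of "of_real (s - t)"] by (simp flip: of_real_diff)
      qed
      ultimately have "l2n (\<lambda>n. X s n - X t n) \<le> \<bar>s - t\<bar> * (?D s + l2n (gen (X t)))"
        by (simp add: add.commute mult_left_mono)
      moreover have "0 \<le> l2n (\<lambda>n. X s n - X t n)"
        by (intro l2n_nonneg ell2_diff sol_ell2 X s0)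
      ultimately show "norm (l2n (\<lambda>n. X s n - X t n)) \<le> \<bar>s - t\<bar> * (?D s + l2n (gen (X t)))" by simp
    qed
  qed
qed

lemma continuous_on_l2n_sol:
  assumes X: "sol X"
  shows "continuous_on {0..} (\<lambda>t. l2n (X t))"
  unfolding continuous_on_def
proof
  fix t :: real assume t: "t \<in> {0..}"
  then have t0: "t \<ge> 0" by simp
  have "((\<lambda>s. l2n (X s) - l2n (X t)) \<longlongrightarrow> 0) (at t within {0..})"
  proof (rule Lim_null_comparison[OF _ sol_norm_continuous[OF X t0]])
    show "\<forall>\<^sub>F s in at t within {0..}. norm (l2n (X s) - l2n (X t)) \<le> l2n (\<lambda>n. X s n - X t n)"
      unfolding eventually_at_filter
    proof (intro always_eventually allI impI)
      fix s assume "s \<noteq> t" "s \<in> {0..}"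
      then have "s \<ge> 0" by simp
      note e = sol_ell2[OF X t0] sol_ell2[OF X this]
      show "norm (l2n (X s) - l2n (X t)) \<le> l2n (\<lambda>n. X s n - X t n)"
        using l2n_le_add_diff[OF e] l2n_le_add_diff[OF e(2,1)] l2n_minus_commute[of "X s" "X t"]
        by (simp add: abs_le_iff)
    qed
  qed
  then show "((\<lambda>t. l2n (X t)) \<longlongrightarrow> l2n (X t)) (at t within {0..})" by (rule LIM_zero_cancel)
qed

lemma continuous_on_out_sol:
  assumes X: "sol X"
  shows "continuous_on {0..} (\<lambda>t. out (X t))"
  unfolding continuous_on_def
proof
  fix t :: real assume t: "t \<in> {0..}"
  then have t0: "t \<ge> 0" by simp
  have lim: "((\<lambda>s. sqrt bsq * l2n (\<lambda>n. X s n - X t n)) \<longlongrightarrow> 0) (at t within {0..})"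
    by (rule tendsto_mult_right_zero[OF sol_norm_continuous[OF X t0]])
  have "((\<lambda>s. out (X s) - out (X t)) \<longlongrightarrow> 0) (at t within {0..})"
  proof (rule Lim_null_comparison[OF _ lim])
    show "\<forall>\<^sub>F s in at t within {0..}. norm (out (X s) - out (X t)) \<le> sqrt bsq * l2n (\<lambda>n. X s n - X t n)"
      unfolding eventually_at_filter
    proof (intro always_eventually allI impI)
      fix s assume "s \<noteq> t" "s \<in> {0..}"
      then have "s \<ge> 0" by simp
      note e = sol_ell2[OF X this] sol_ell2[OF X t0]
      show "norm (out (X s) - out (X t)) \<le> sqrt bsq * l2n (\<lambda>n. X s n - X t n)"
        using norm_out_le[OF ell2_diff[OF e]] by (simp add: out_diff[OF e])
    qed
  qed
  then show "((\<lambda>t. out (X t)) \<longlongrightarrow> out (X t)) (at t within {0..})" by (rule LIM_zero_cancel)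
qed

text \<open>A coordinate is dominated by the \<open>ell2\<close> norm, so norm differentiability
  yields scalar equations to which the fundamental theorem of calculus applies.\<close>

lemma sol_coordinate_derivative:
  assumes X: "sol X" "t \<ge> 0"
  shows "((\<lambda>s. X s n) has_vector_derivative gen (X t) n) (at t within {0..})"
  unfolding has_vector_derivative_def has_derivative_iff_norm
proof
  show "bounded_linear (\<lambda>h::real. h *\<^sub>R gen (X t) n)" by (rule bounded_linear_scaleR_left)
  show "((\<lambda>s. norm (X s n - X t n - (s - t) *\<^sub>R gen (X t) n) / norm (s - t)) \<longlongrightarrow> 0) (at t within {0..})"
  proof (rule Lim_null_comparison[OF _ sol_tendsto[OF X]])
    show "\<forall>\<^sub>F s in at t within {0..}. norm (norm (X s n - X t n - (s - t) *\<^sub>R gen (X t) n) / norm (s - t))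
        \<le> l2n (\<lambda>n. (X s n - X t n) / of_real (s - t) - gen (X t) n)"
      unfolding eventually_at_filter
    proof (intro always_eventually allI impI)
      fix s assume s: "s \<noteq> t" "s \<in> {0..}"
      then have s0: "s \<ge> 0" by simp
      have "norm (norm (X s n - X t n - (s - t) *\<^sub>R gen (X t) n) / norm (s - t))
          = norm ((X s n - X t n - (s - t) *\<^sub>R gen (X t) n) / of_real (s - t))"
        by (simp add: norm_divide flip: of_real_diff)
      also have "(X s n - X t n - (s - t) *\<^sub>R gen (X t) n) / of_real (s - t)
         = (X s n - X t n) / of_real (s - t) - gen (X t) n"
        using s by (simp add: scaleR_conv_of_real diff_divide_distrib flip: of_real_diff)
      also have "norm \<dots> \<le> l2n (\<lambda>n. (X s n - X t n) / of_real (s - t) - gen (X t) n)"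
        by (rule norm_le_l2n[OF ell2_diff[OF sol_ell2_quotient[OF X s0] sol_ell2_gen[OF X]]])
      finally show "norm (norm (X s n - X t n - (s - t) *\<^sub>R gen (X t) n) / norm (s - t))
        \<le> l2n (\<lambda>n. (X s n - X t n) / of_real (s - t) - gen (X t) n)" .
    qed
  qed
qed

text \<open>Autonomy: estimates are proved from time 0 and restarted at later times through this
  lemma.\<close>

lemma sol_shift:
  assumes X: "sol X" and r: "r \<ge> 0"
  shows "sol (\<lambda>t. X (t + r))"
  unfolding sol_def
proof (intro allI impI conjI)
  fix t :: real assume t: "t \<ge> 0"
  then have tr: "t + r \<ge> 0" using r by simp
  show "ell2 (X (t + r))" "ell2 (\<lambda>n. of_real (\<mu> n) * X (t + r) n)"
    using sol_ell2[OF X tr] sol_ell2_mu[OF X tr] .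
  have "filterlim (\<lambda>s. s + r) (at (t + r) within {0..}) (at t within {0..})"
    unfolding filterlim_at
    by (auto intro!: tendsto_intros simp: eventually_at_filter r)
  from filterlim_compose[OF sol_tendsto[OF X tr] this]
  show "((\<lambda>s. l2n (\<lambda>n. (X (s + r) n - X (t + r) n) / of_real (s - t) - gen (X (t + r)) n)) \<longlongrightarrow> 0)
      (at t within {0..})" by simp
qed

lemma sol_diff:
  assumes X: "sol X" and Z: "sol Z"
  shows "sol (\<lambda>t n. X t n - Z t n)"
  unfolding sol_def
proof (intro allI impI conjI)
  fix t :: real assume t: "t \<ge> 0"
  show "ell2 (\<lambda>n. X t n - Z t n)" by (intro ell2_diff sol_ell2 X Z t)
  show "ell2 (\<lambda>n. of_real (\<mu> n) * (X t n - Z t n))"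
    unfolding right_diff_distrib by (intro ell2_diff sol_ell2_mu X Z t)
  let ?DX = "\<lambda>s n. (X s n - X t n) / of_real (s - t) - gen (X t) n"
  let ?DZ = "\<lambda>s n. (Z s n - Z t n) / of_real (s - t) - gen (Z t) n"
  let ?D = "\<lambda>s n. (X s n - Z s n - (X t n - Z t n)) / of_real (s - t) - gen (\<lambda>n. X t n - Z t n) n"
  have lim: "((\<lambda>s. l2n (?DX s) + l2n (?DZ s)) \<longlongrightarrow> 0) (at t within {0..})"
    using tendsto_add[OF sol_tendsto[OF X t] sol_tendsto[OF Z t]] by simp
  show "((\<lambda>s. l2n (?D s)) \<longlongrightarrow> 0) (at t within {0..})"
  proof (rule Lim_null_comparison[OF _ lim])
    show "\<forall>\<^sub>F s in at t within {0..}. norm (l2n (?D s)) \<le> l2n (?DX s) + l2n (?DZ s)"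
      unfolding eventually_at_filter
    proof (intro always_eventually allI impI)
      fix s assume s: "s \<noteq> t" "s \<in> {0..}"
      then have s0: "s \<ge> 0" by simp
      have e: "ell2 (?DX s)" "ell2 (?DZ s)"
        by (intro ell2_diff sol_ell2_quotient sol_ell2_gen X Z t s0)+
      have eq: "?D s = (\<lambda>n. ?DX s n + - ?DZ s n)"
        using gen_diff[OF sol_ell2[OF X t] sol_ell2[OF Z t]]
        by (simp add: fun_eq_iff diff_divide_distrib)
      have "l2n (?D s) \<le> l2n (?DX s) + l2n (?DZ s)"
        unfolding eq using l2n_add[OF e(1) ell2_uminus[OF e(2)]] by (simp only: l2n_uminus)
      moreover have "0 \<le> l2n (?D s)" unfolding eq by (intro l2n_nonneg ell2_add ell2_uminus e)
      ultimately show "norm (l2n (?D s)) \<le> l2n (?DX s) + l2n (?DZ s)" by simp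
    qed
  qed
qed

lemma sol_bounded:
  assumes "sol X"
  obtains M where "M \<ge> 0" "\<And>t. t \<in> {0..T} \<Longrightarrow> l2n (X t) \<le> M"
proof -
  have "continuous_on {0..T} (\<lambda>t. l2n (X t))"
    by (rule continuous_on_subset[OF continuous_on_l2n_sol[OF assms]]) auto
  then have "bounded ((\<lambda>t. l2n (X t)) ` {0..T})"
    by (intro compact_imp_bounded compact_continuous_image) auto
  then obtain M where "M > 0" "\<forall>y \<in> (\<lambda>t. l2n (X t)) ` {0..T}. norm y \<le> M"
    by (auto simp: bounded_pos)
  then show ?thesis using that[of M] by force
qed

section \<open>Energy identity and contractivity\<close>

text \<open>The energy formally has derivative \<open>- 2 * g * (cmod Y)^2\<close>. The identity is
  integrated for the first \<open>N\<close> coordinates, where one factor \<open>Y\<close> is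
  replaced by its partial sum \<open>YN\<close>, and the error vanishes with
  \<open>tail N\<close>.\<close>

lemma sol_energy:
  assumes X: "sol X" and T: "T \<ge> 0"
  shows "(l2n (X 0))\<^sup>2 - (l2n (X T))\<^sup>2 = 2 * g * integral {0..T} (\<lambda>t. (cmod (out (X t)))\<^sup>2)"
proof -
  define Y where "Y t = out (X t)" for t
  define YN where "YN N t = (\<Sum>n<N. of_real (b n) * X t n)" for N t
  define EN where "EN N t = (\<Sum>n<N. (cmod (X t n))\<^sup>2)" for N :: nat and t
  define J where "J = integral {0..T} (\<lambda>t. (cmod (Y t))\<^sup>2)"
  obtain M where M: "M \<ge> 0" "\<And>t. t \<in> {0..T} \<Longrightarrow> l2n (X t) \<le> M" using sol_bounded[OF X] by blast
  have Yc: "continuous_on {0..T} Y"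
    unfolding Y_def by (rule continuous_on_subset[OF continuous_on_out_sol[OF X]]) auto
  have J: "((\<lambda>t. (cmod (Y t))\<^sup>2) has_integral J) {0..T}"
    unfolding J_def by (intro integrable_integral integrable_continuous_real continuous_intros Yc)
  have D: "(EN N has_vector_derivative - (2 * g) * (YN N t \<bullet> Y t)) (at t within {0..T})" if t: "t \<in> {0..T}" for N t
  proof -
    have t0: "t \<ge> 0" using t by simp
    have "((\<lambda>s. X s n) has_vector_derivative gen (X t) n) (at t within {0..T})" for n
      by (rule has_vector_derivative_within_subset[OF sol_coordinate_derivative[OF X t0]]) auto
    then have "((\<lambda>s. X s n \<bullet> X s n) has_vector_derivative (X t n \<bullet> gen (X t) n + gen (X t) n \<bullet> X t n)) (at t within {0..T})" for n
      by (intro bounded_bilinear.has_vector_derivative[OF bounded_bilinear_inner])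
    then have "((\<lambda>s. \<Sum>n<N. X s n \<bullet> X s n) has_vector_derivative (\<Sum>n<N. X t n \<bullet> gen (X t) n + gen (X t) n \<bullet> X t n)) (at t within {0..T})"
      by (intro has_vector_derivative_sum)
    moreover have "(\<Sum>n<N. X t n \<bullet> gen (X t) n + gen (X t) n \<bullet> X t n) = - (2 * g) * (YN N t \<bullet> Y t)"
    proof -
      \<comment> \<open>The term \<open>\<i> * \<mu> n * X t n\<close> is orthogonal to
        \<open>X t n\<close> in the real inner product, so only the damping remains.\<close>
      have "X t n \<bullet> gen (X t) n + gen (X t) n \<bullet> X t n = - (2 * g) * ((of_real (b n) * X t n) \<bullet> Y t)" for n
        by (simp add: gen_def inner_complex_def Y_def algebra_simps)
      then show ?thesis by (simp add: YN_def inner_sum_left sum_distrib_left)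
    qed
    ultimately show ?thesis by (simp add: EN_def[abs_def] dot_square_norm)
  qed
  have bound: "norm ((EN N T - EN N 0) + 2 * g * J) \<le> 2 * g * (tail N * M * (sqrt bsq * M)) * T" for N
  proof -
    have "((\<lambda>t. - (2 * g) * (YN N t \<bullet> Y t)) has_integral (EN N T - EN N 0)) {0..T}"
      using D T by (intro fundamental_theorem_of_calculus) auto
    from has_integral_add[OF this has_integral_mult_right[OF J, of "2 * g"]]
    have I: "((\<lambda>t. - (2 * g) * (YN N t \<bullet> Y t) + 2 * g * (cmod (Y t))\<^sup>2) has_integral ((EN N T - EN N 0) + 2 * g * J)) {0..T}" .
    have "norm ((EN N T - EN N 0) + 2 * g * J) \<le> 2 * g * (tail N * M * (sqrt bsq * M)) * measure lborel {0..T}"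
    proof (rule has_integral_bound_real[OF _ finite.emptyI I])
      show "0 \<le> 2 * g * (tail N * M * (sqrt bsq * M))" using g_pos M bsq_nonneg tail_nonneg by simp
      fix t assume "t \<in> {0..T} - {}"
      then have t: "t \<in> {0..T}" and t0: "t \<ge> 0" by simp_all
      have "- (2 * g) * (YN N t \<bullet> Y t) + 2 * g * (cmod (Y t))\<^sup>2 = 2 * g * ((Y t - YN N t) \<bullet> Y t)"
        by (simp add: inner_diff_left power2_norm_eq_inner algebra_simps)
      moreover have "\<bar>(Y t - YN N t) \<bullet> Y t\<bar> \<le> tail N * M * (sqrt bsq * M)"
      proof -
        have "\<bar>(Y t - YN N t) \<bullet> Y t\<bar> \<le> cmod (Y t - YN N t) * cmod (Y t)" by (rule Cauchy_Schwarz_ineq2)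
        also have "\<dots> \<le> (tail N * l2n (X t)) * (sqrt bsq * l2n (X t))"
          unfolding Y_def YN_def using sol_ell2[OF X t0]
          by (intro mult_mono out_truncate norm_out_le) (auto simp: tail_nonneg l2n_nonneg)
        also have "\<dots> \<le> tail N * M * (sqrt bsq * M)"
          using M(2)[OF t] M(1) sol_ell2[OF X t0] tail_nonneg bsq_nonneg
          by (intro mult_mono mult_left_mono) (auto simp: l2n_nonneg)
        finally show ?thesis .
      qed
      ultimately show "norm (- (2 * g) * (YN N t \<bullet> Y t) + 2 * g * (cmod (Y t))\<^sup>2) \<le> 2 * g * (tail N * M * (sqrt bsq * M))"
        using g_pos by (simp add: abs_mult)
    qed
    then show ?thesis using T by simp
  qed
  have ENlim: "(\<lambda>N. EN N t) \<longlonglongrightarrow> (l2n (X t))\<^sup>2" if "t \<ge> 0" for t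
    using sol_ell2[OF X that] unfolding EN_def
    by (simp add: l2n_squared) (simp add: ell2_def summable_LIMSEQ)
  have "(\<lambda>N. (EN N T - EN N 0) + 2 * g * J) \<longlonglongrightarrow> ((l2n (X T))\<^sup>2 - (l2n (X 0))\<^sup>2) + 2 * g * J"
    using T by (intro tendsto_intros ENlim) auto
  moreover have "(\<lambda>N. (EN N T - EN N 0) + 2 * g * J) \<longlonglongrightarrow> 0"
  proof (rule Lim_null_comparison)
    show "\<forall>\<^sub>F N in sequentially. norm ((EN N T - EN N 0) + 2 * g * J) \<le> 2 * g * (tail N * M * (sqrt bsq * M)) * T"
      using bound by simp
    have "(\<lambda>N. 2 * g * (tail N * M * (sqrt bsq * M)) * T) \<longlonglongrightarrow> 2 * g * (0 * M * (sqrt bsq * M)) * T"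
      by (intro tendsto_intros tail_tendsto)
    then show "(\<lambda>N. 2 * g * (tail N * M * (sqrt bsq * M)) * T) \<longlonglongrightarrow> 0" by simp
  qed
  ultimately have "((l2n (X T))\<^sup>2 - (l2n (X 0))\<^sup>2) + 2 * g * J = 0" by (rule LIMSEQ_unique)
  then show ?thesis unfolding J_def Y_def by simp
qed

lemma sol_contractive:
  assumes X: "sol X" and T: "T \<ge> 0"
  shows "l2n (X T) \<le> l2n (X 0)"
proof -
  have "0 \<le> integral {0..T} (\<lambda>t. (cmod (out (X t)))\<^sup>2)"
    by (rule integral_nonneg)
       (auto intro!: integrable_continuous_real continuous_intros continuous_on_subset[OF continuous_on_out_sol[OF X]])
  then have "(l2n (X T))\<^sup>2 \<le> (l2n (X 0))\<^sup>2" using sol_energy[OF X T] g_pos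
    by (smt (verit) mult_nonneg_nonneg)
  then show ?thesis by (rule power2_le_imp_le) (simp add: l2n_nonneg[OF sol_ell2[OF X]])
qed

lemma sol_antimono:
  assumes X: "sol X" and "0 \<le> s" "s \<le> t"
  shows "l2n (X t) \<le> l2n (X s)"
  using sol_contractive[OF sol_shift[OF X \<open>0 \<le> s\<close>], of "t - s"] assms by simp

text \<open>Difference quotients of a solution are solutions, so contractivity passes to the derivative.\<close>
lemma sol_gen_contractive:
  assumes X: "sol X" and t: "t \<ge> 0"
  shows "l2n (gen (X t)) \<le> l2n (gen (X 0))"
proof -
  let ?Q = "\<lambda>t h n. (X (t + h) n - X t n) / of_real h"
  \<comment> \<open>Norms of the quotients converge to the norm of the derivative. Taking
    \<open>h > 0\<close> keeps the shifted solution defined on the whole half-line.\<close>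
  have lim: "((\<lambda>h. l2n (?Q t h)) \<longlongrightarrow> l2n (gen (X t))) (at_right 0)" if t: "t \<ge> 0" for t
  proof -
    have "filterlim (\<lambda>h. t + h) (at t within {0..}) (at_right 0)"
      unfolding filterlim_at using t
      by (auto intro!: tendsto_eq_intros simp: eventually_at_filter)
    from filterlim_compose[OF sol_tendsto[OF X t] this]
    have l: "((\<lambda>h. l2n (\<lambda>n. ?Q t h n - gen (X t) n)) \<longlongrightarrow> 0) (at_right 0)" by simp
    have "((\<lambda>h. l2n (?Q t h) - l2n (gen (X t))) \<longlongrightarrow> 0) (at_right 0)"
    proof (rule Lim_null_comparison[OF _ l])
      show "\<forall>\<^sub>F h in at_right 0. norm (l2n (?Q t h) - l2n (gen (X t))) \<le> l2n (\<lambda>n. ?Q t h n - gen (X t) n)"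
        unfolding eventually_at_filter
      proof (intro always_eventually allI impI)
        fix h :: real assume "h \<noteq> 0" "h \<in> {0<..}"
        then have "ell2 (?Q t h)" using sol_ell2_quotient[OF X t, of "t + h"] t by simp
        note e = this sol_ell2_gen[OF X t]
        show "norm (l2n (?Q t h) - l2n (gen (X t))) \<le> l2n (\<lambda>n. ?Q t h n - gen (X t) n)"
          using l2n_le_add_diff[OF e] l2n_le_add_diff[OF e(2,1)] l2n_minus_commute[of "?Q t h" "gen (X t)"]
          by (simp add: abs_le_iff)
      qed
    qed
    then show ?thesis by (rule LIM_zero_cancel)
  qed
  have "\<forall>\<^sub>F h in at_right 0. l2n (?Q t h) \<le> l2n (?Q 0 h)"
    unfolding eventually_at_filter
  proof (intro always_eventually allI impI)
    fix h :: real assume "h \<noteq> 0" "h \<in> {0<..}"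
    then have h: "h > 0" by simp
    have s: "sol (\<lambda>t n. X (t + h) n - X t n)" using sol_diff[OF sol_shift[OF X] X, of h] h by simp
    have e: "ell2 (\<lambda>n. X (t + h) n - X t n)" "ell2 (\<lambda>n. X (0 + h) n - X 0 n)"
      using sol_ell2[OF s, of t] sol_ell2[OF s, of 0] t by auto
    have "l2n (\<lambda>n. (1 / of_real h) * (X (t + h) n - X t n)) \<le> l2n (\<lambda>n. (1 / of_real h) * (X (0 + h) n - X 0 n))"
      unfolding l2n_cmult[OF e(1)] l2n_cmult[OF e(2)]
      using sol_contractive[OF s t] by (intro mult_left_mono) auto
    then show "l2n (?Q t h) \<le> l2n (?Q 0 h)" by simp
  qed
  then show ?thesis
    by (rule tendsto_le[OF _ lim[OF order.refl] lim[OF t], rotated]) simp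
qed

end

section \<open>Two real estimates: Cauchy-Schwarz for integrals and decay of a recurrence\<close>

text \<open>Integrate the square of \<open>f\<close> minus its mean \<open>Q / T\<close>.\<close>

lemma square_integral_le:
  fixes f :: "real \<Rightarrow> real"
  assumes f: "continuous_on {0..T} f" and T: "T > 0"
  shows "(integral {0..T} f)\<^sup>2 \<le> T * integral {0..T} (\<lambda>t. (f t)\<^sup>2)"
proof -
  define Q where "Q = integral {0..T} f"
  define J where "J = integral {0..T} (\<lambda>t. (f t)\<^sup>2)"
  have Q: "(f has_integral Q) {0..T}"
    unfolding Q_def by (intro integrable_integral integrable_continuous_real f)
  have J: "((\<lambda>t. (f t)\<^sup>2) has_integral J) {0..T}"
    unfolding J_def by (intro integrable_integral integrable_continuous_real continuous_intros f)
  have c: "((\<lambda>t. (Q/T)\<^sup>2) has_integral (T * (Q/T)\<^sup>2)) {0..T}"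
    using has_integral_const_real[of "(Q/T)\<^sup>2" 0 T] T by simp
  have "((\<lambda>t. (f t)\<^sup>2 - 2 * (Q/T) * f t + (Q/T)\<^sup>2) has_integral (J - 2 * (Q/T) * Q + T * (Q/T)\<^sup>2)) {0..T}"
    by (intro has_integral_add has_integral_diff has_integral_mult_right J Q c)
  then have "0 \<le> J - 2 * (Q/T) * Q + T * (Q/T)\<^sup>2"
  proof (rule has_integral_nonneg)
    fix t
    have "0 \<le> (f t - Q/T)\<^sup>2" by simp
    then show "0 \<le> (f t)\<^sup>2 - 2 * (Q/T) * f t + (Q/T)\<^sup>2" by (simp add: power2_diff algebra_simps)
  qed
  also have "\<dots> = J - Q\<^sup>2 / T" using T by (simp add: field_simps power2_eq_square)
  finally show ?thesis using T unfolding Q_def[symmetric] J_def[symmetric] by (simp add: field_simps)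
qed

text \<open>The sequence \<open>u powr (-s)\<close> grows by at least \<open>s * \<eta>\<close> per step.\<close>
lemma power_decay_recurrence:
  fixes u :: "nat \<Rightarrow> real"
  assumes s: "s > 0" and eta: "\<eta> > 0" and K: "K > 0" "u 0 \<le> K"
    and nonneg: "\<And>k. 0 \<le> u k"
    and step: "\<And>k. u (Suc k) \<le> u k - \<eta> * u k powr (1 + s)"
    and a: "a = min (K powr (- s)) (s * \<eta>)"
  shows "u k \<le> (a * (real k + 1)) powr (- 1 / s)"
proof -
  have a0: "a > 0" using assms by auto
  \<comment> \<open>Since \<open>0 powr (- s)\<close> is 0, the growth claim is restricted to
    positive \<open>u k\<close>. In the minimum \<open>a\<close>, the first entry serves the base
    case and the second the induction step.\<close>
  have grow: "a * (real k + 1) \<le> u k powr (- s)" if "0 < u k" for k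
    using that
  proof (induction k)
    case 0
    have "K powr (- s) \<le> u 0 powr (- s)"
      using K s 0 by (intro powr_mono2') auto
    then show ?case using a by simp
  next
    case (Suc k)
    have pos: "0 < u k"
    proof (rule ccontr)
      assume "\<not> 0 < u k"
      then have "u k = 0" using nonneg[of k] by simp
      with step[of k] Suc.prems show False by simp
    qed
    define q where "q = u (Suc k) / u k"
    have q0: "q > 0" using Suc.prems pos by (simp add: q_def)
    have u: "u (Suc k) = u k * q" using pos by (simp add: q_def)
    have "u k * q \<le> u k * (1 - \<eta> * u k powr s)"
      using step[of k] pos by (simp add: u powr_add algebra_simps)
    then have q1: "\<eta> * u k powr s \<le> 1 - q" using pos by simp
    \<comment> \<open>A Bernoulli-type bound for the ratio \<open>q\<close> of consecutive terms,
      from \<open>ln q \<le> q - 1\<close> and \<open>1 + x \<le> exp x\<close>.\<close>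
    have "1 + s * (1 - q) \<le> 1 + (- s * ln q)"
      using mult_left_mono[OF ln_le_minus_one[OF q0], of s] s by (simp add: algebra_simps)
    also have "\<dots> \<le> exp (- s * ln q)" by (rule exp_ge_add_one_self)
    also have "\<dots> = q powr (- s)" using q0 by (simp add: powr_def)
    finally have q2: "1 + s * (1 - q) \<le> q powr (- s)" .
    have "s * (\<eta> * u k powr s) \<le> s * (1 - q)" using q1 s by (intro mult_left_mono) auto
    with q2 have q3: "1 + s * \<eta> * u k powr s \<le> q powr (- s)" by (simp add: mult.assoc)
    have "a * (real k + 1) + s * \<eta> \<le> u k powr (- s) + s * \<eta>" using Suc.IH[OF pos] by simp
    also have "\<dots> = u k powr (- s) * (1 + s * \<eta> * u k powr s)"
      using pos by (simp add: algebra_simps powr_minus)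
    also have "\<dots> \<le> u k powr (- s) * q powr (- s)" using q3 by (intro mult_left_mono) auto
    also have "\<dots> = u (Suc k) powr (- s)" using pos q0 by (simp add: u powr_mult)
    finally have "a * (real k + 1) + s * \<eta> \<le> u (Suc k) powr (- s)" .
    moreover have "a \<le> s * \<eta>" using a by simp
    ultimately show ?case by (simp add: algebra_simps)
  qed
  show ?thesis
  proof (cases "u k > 0")
    case True
    have "(u k powr (- s)) powr (- 1 / s) \<le> (a * (real k + 1)) powr (- 1 / s)"
      using a0 s grow[OF True] by (intro powr_mono2') auto
    then show ?thesis using True s by (simp add: powr_powr)
  next
    case False
    then show ?thesis using nonneg[of k] by (metis less_eq_real_def not_less powr_ge_zero order.trans)
  qed
qed

section \<open>Comparison with the free evolution, and interpolation between frequencies\<close>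

context rank_one_damping
begin

text \<open>Variation of constants: the factor \<open>exp (- \<i> * \<mu> n * s)\<close> removes the
  oscillation and leaves only the damping term to integrate. Extending the integral to
  \<open>T\<close> makes the bound uniform in \<open>t\<close>.\<close>

lemma sol_transport:
  assumes X: "sol X" and t: "0 \<le> t" "t \<le> T"
  shows "cmod (X t n - cis (\<mu> n * t) * X 0 n) \<le> g * \<bar>b n\<bar> * integral {0..T} (\<lambda>s. cmod (out (X s)))"
proof -
  define k where "k = - \<i> * of_real (\<mu> n)"
  have Yc: "continuous_on S (\<lambda>s. out (X s))" if "S \<subseteq> {0..}" for S
    by (rule continuous_on_subset[OF continuous_on_out_sol[OF X] that])
  have Yi: "(\<lambda>s. cmod (out (X s))) integrable_on {0..r}" for r
    by (intro integrable_continuous_real continuous_intros Yc) auto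
  have D: "((\<lambda>s. exp (k * of_real s) * X s n) has_vector_derivative
        (exp (k * of_real s) * gen (X s) n + (exp (k * of_real s) * k) * X s n)) (at s within {0..t})"
    if s: "s \<in> {0..t}" for s
  proof (rule has_vector_derivative_mult)
    show "((\<lambda>s. exp (k * of_real s)) has_vector_derivative exp (k * of_real s) * k) (at s within {0..t})"
      by (rule has_vector_derivative_real_field) (auto intro!: derivative_eq_intros)
    show "((\<lambda>s. X s n) has_vector_derivative gen (X s) n) (at s within {0..t})"
      using s by (intro has_vector_derivative_within_subset[OF sol_coordinate_derivative[OF X]]) auto
  qed
  have eq: "exp (k * of_real s) * gen (X s) n + (exp (k * of_real s) * k) * X s n
      = - (of_real (g * b n) * (exp (k * of_real s) * out (X s)))" for s
    by (simp add: gen_def k_def algebra_simps)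
  have nexp: "cmod (exp (k * of_real s)) = 1" for s by (simp add: k_def)
  have I: "((\<lambda>s. - (of_real (g * b n) * (exp (k * of_real s) * out (X s)))) has_integral
      (exp (k * of_real t) * X t n - exp (k * of_real 0) * X 0 n)) {0..t}"
    using D t unfolding eq by (intro fundamental_theorem_of_calculus) auto
  have "cmod (X t n - cis (\<mu> n * t) * X 0 n) = cmod (exp (k * of_real t) * (X t n - cis (\<mu> n * t) * X 0 n))"
    by (simp only: norm_mult nexp mult_1)
  also have "exp (k * of_real t) * (X t n - cis (\<mu> n * t) * X 0 n) = exp (k * of_real t) * X t n - exp (k * of_real 0) * X 0 n"
  proof -
    have "exp (k * of_real t) * cis (\<mu> n * t) = 1"
      by (simp add: k_def cis_conv_exp mult.assoc flip: exp_add)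
    then show ?thesis by (simp add: right_diff_distrib flip: mult.assoc)
  qed
  also have "\<dots> = integral {0..t} (\<lambda>s. - (of_real (g * b n) * (exp (k * of_real s) * out (X s))))"
    by (rule integral_unique[OF I, symmetric])
  also have "cmod \<dots> \<le> integral {0..t} (\<lambda>s. g * \<bar>b n\<bar> * cmod (out (X s)))"
  proof (rule integral_norm_bound_integral)
    show "(\<lambda>s. - (of_real (g * b n) * (exp (k * of_real s) * out (X s)))) integrable_on {0..t}"
      using I by blast
    show "(\<lambda>s. g * \<bar>b n\<bar> * cmod (out (X s))) integrable_on {0..t}"
      by (intro integrable_on_mult_right Yi)
    show "norm (- (of_real (g * b n) * (exp (k * of_real s) * out (X s)))) \<le> g * \<bar>b n\<bar> * cmod (out (X s))" for s
      using g_pos by (simp add: norm_mult k_def abs_mult)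
  qed
  also have "\<dots> = g * \<bar>b n\<bar> * integral {0..t} (\<lambda>s. cmod (out (X s)))" by simp
  also have "\<dots> \<le> g * \<bar>b n\<bar> * integral {0..T} (\<lambda>s. cmod (out (X s)))"
    using g_pos t by (intro mult_left_mono integral_subset_le Yi) auto
  finally show ?thesis .
qed

text \<open>With \<open>f = gen x\<close>, each mode is solved for \<open>x n\<close> in terms of
  \<open>f n\<close> and the scalar \<open>Y = out x\<close>. Applying \<open>out\<close> gives a
  scalar equation for \<open>Y\<close>, so \<open>Y\<close> and then \<open>\<mu> n * x n\<close>
  are controlled by \<open>f\<close>.\<close>

lemma l2n_mu_le_gen:
  assumes m: "m > 0" "\<And>n. m \<le> \<bar>\<mu> n\<bar>" and x: "ell2 x" and mx: "ell2 (\<lambda>n. of_real (\<mu> n) * x n)"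
  shows "l2n (\<lambda>n. of_real (\<mu> n) * x n) \<le> (1 + g * bsq / m) * l2n (gen x)"
proof -
  have mu0: "\<mu> n \<noteq> 0" for n using m(1) m(2)[of n] by auto
  define f where "f = gen x"
  define Y where "Y = out x"
  have f: "ell2 f" unfolding f_def by (rule ell2_gen[OF mx])
  have small: "ell2 (\<lambda>n. y n / (\<i> * of_real (\<mu> n)))" "l2n (\<lambda>n. y n / (\<i> * of_real (\<mu> n))) \<le> l2n y / m"
    if y: "ell2 y" for y
  proof -
    have e: "ell2 (\<lambda>n. (1 / of_real m) * y n)" by (rule ell2_cmult[OF y])
    have le: "cmod (y n / (\<i> * of_real (\<mu> n))) \<le> cmod ((1 / of_real m) * y n)" for n
    proof -
      have "cmod (y n) / \<bar>\<mu> n\<bar> \<le> cmod (y n) / m"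
        using m(1) m(2)[of n] mu0[of n] by (intro divide_left_mono) auto
      then show ?thesis using m by (simp add: norm_divide norm_mult)
    qed
    show "ell2 (\<lambda>n. y n / (\<i> * of_real (\<mu> n)))" by (rule l2n_norm_le(1)[OF e le])
    show "l2n (\<lambda>n. y n / (\<i> * of_real (\<mu> n))) \<le> l2n y / m"
      using l2n_norm_le(2)[OF e le] l2n_cmult[OF y, of "1 / of_real m"] m by (simp add: norm_divide)
  qed
  define v where "v n = f n / (\<i> * of_real (\<mu> n))" for n
  define w where "w n = of_real (b n) / (\<i> * of_real (\<mu> n))" for n
  have v: "ell2 v" unfolding v_def by (rule small[OF f])
  have w: "ell2 w" unfolding w_def by (rule small[OF ell2_b])
  have xeq: "x n = v n + of_real g * Y * w n" for n
    using mu0[of n] by (simp add: v_def w_def f_def gen_def Y_def field_simps)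
  have "Y = out v + of_real g * Y * out w"
  proof -
    have "(\<lambda>n. of_real (b n) * v n + of_real g * Y * (of_real (b n) * w n)) sums (out v + of_real g * Y * out w)"
      unfolding out_def by (intro sums_add sums_mult summable_sums summable_out v w)
    then have "(\<lambda>n. of_real (b n) * x n) sums (out v + of_real g * Y * out w)"
      unfolding xeq by (simp add: algebra_simps)
    then show ?thesis unfolding Y_def[unfolded out_def] by (simp add: sums_iff)
  qed
  then have Yeq: "Y * (1 - of_real g * out w) = out v" by (simp add: algebra_simps)
  \<comment> \<open>\<open>out w\<close> is purely imaginary, so the factor multiplying \<open>Y\<close> has modulus at least 1.\<close>
  have "Re (out w) = (\<Sum>n. Re (of_real (b n) * w n))"
    unfolding out_def by (rule Re_suminf[OF summable_out[OF w]])
  also have "\<dots> = 0" by (simp add: w_def Re_divide)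
  finally have "Re (1 - of_real g * out w) = 1" by simp
  then have "1 \<le> cmod (1 - of_real g * out w)" by (metis complex_Re_le_cmod)
  then have "cmod Y \<le> cmod Y * cmod (1 - of_real g * out w)" by (simp add: mult_le_cancel_left1)
  also have "\<dots> = cmod (out v)" by (simp only: Yeq[symmetric] norm_mult)
  also have "\<dots> \<le> sqrt bsq * l2n v" by (rule norm_out_le[OF v])
  also have "\<dots> \<le> sqrt bsq * (l2n f / m)"
    unfolding v_def by (intro mult_left_mono small f) (simp add: bsq_nonneg)
  finally have Yle: "cmod Y \<le> sqrt bsq * (l2n f / m)" .
  have eb: "ell2 (\<lambda>n. (of_real g * Y) * of_real (b n))" by (rule ell2_cmult[OF ell2_b])
  have "l2n (\<lambda>n. of_real (\<mu> n) * x n) = l2n (\<lambda>n. \<i> * (of_real (\<mu> n) * x n))"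
    using l2n_cmult[OF mx, of \<i>] by simp
  also have "(\<lambda>n. \<i> * (of_real (\<mu> n) * x n)) = (\<lambda>n. f n + (of_real g * Y) * of_real (b n))"
    by (simp add: fun_eq_iff f_def gen_def Y_def algebra_simps)
  also have "l2n \<dots> \<le> l2n f + l2n (\<lambda>n. (of_real g * Y) * of_real (b n))" by (rule l2n_add[OF f eb])
  also have "l2n (\<lambda>n. (of_real g * Y) * of_real (b n)) = g * cmod Y * sqrt bsq"
    using l2n_cmult[OF ell2_b, of "of_real g * Y"] g_pos by (simp add: l2n_b norm_mult)
  also have "l2n f + g * cmod Y * sqrt bsq \<le> l2n f + g * (sqrt bsq * (l2n f / m)) * sqrt bsq"
    using Yle g_pos bsq_nonneg by (intro add_left_mono mult_right_mono mult_left_mono) auto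
  also have "\<dots> = (1 + g * bsq / m) * l2n f"
    using bsq_nonneg by (simp add: algebra_simps flip: power2_eq_square)
  finally show ?thesis by (simp add: f_def)
qed

text \<open>The modes are split at frequency \<open>R\<close>: below it the weight \<open>b\<^sup>2\<close> is large, above it \<open>\<mu>\<^sup>2\<close> is.\<close>
lemma l2n_interpolation:
  assumes low: "\<beta>1 > 0" "\<And>n. \<beta>1 \<le> (b n)\<^sup>2 * \<bar>\<mu> n\<bar> powr \<alpha>" and al: "\<alpha> > 0" and R: "R > 0"
    and x: "ell2 x" and mx: "ell2 (\<lambda>n. of_real (\<mu> n) * x n)"
    and W: "\<And>N. (\<Sum>n<N. (b n)\<^sup>2 * (cmod (x n))\<^sup>2) \<le> W"
  shows "(l2n x)\<^sup>2 \<le> R powr \<alpha> / \<beta>1 * W + (l2n (\<lambda>n. of_real (\<mu> n) * x n))\<^sup>2 / R\<^sup>2"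
proof -
  have pt: "1 \<le> R powr \<alpha> / \<beta>1 * (b n)\<^sup>2 + (\<mu> n)\<^sup>2 / R\<^sup>2" for n
  proof (cases "\<bar>\<mu> n\<bar> \<le> R")
    case True
    have "\<beta>1 \<le> (b n)\<^sup>2 * \<bar>\<mu> n\<bar> powr \<alpha>" by (rule low)
    also have "\<dots> \<le> (b n)\<^sup>2 * R powr \<alpha>" using True al by (intro mult_left_mono powr_mono2) auto
    finally have "1 \<le> R powr \<alpha> / \<beta>1 * (b n)\<^sup>2" using low(1) by (simp add: field_simps)
    then show ?thesis by (smt (verit) zero_le_power2 divide_nonneg_nonneg)
  next
    case False
    then have "R\<^sup>2 \<le> \<bar>\<mu> n\<bar>\<^sup>2" using R by (intro power_mono) auto
    then have "1 \<le> (\<mu> n)\<^sup>2 / R\<^sup>2" using R by simp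
    moreover have "0 \<le> R powr \<alpha> / \<beta>1 * (b n)\<^sup>2" using low(1) by simp
    ultimately show ?thesis by linarith
  qed
  have "(\<Sum>n<N. (cmod (x n))\<^sup>2) \<le> R powr \<alpha> / \<beta>1 * W + (l2n (\<lambda>n. of_real (\<mu> n) * x n))\<^sup>2 / R\<^sup>2" for N
  proof -
    have "(\<Sum>n<N. (cmod (x n))\<^sup>2) \<le> (\<Sum>n<N. (R powr \<alpha> / \<beta>1 * (b n)\<^sup>2 + (\<mu> n)\<^sup>2 / R\<^sup>2) * (cmod (x n))\<^sup>2)"
      using pt by (intro sum_mono) (simp add: mult_le_cancel_right1)
    also have "\<dots> = R powr \<alpha> / \<beta>1 * (\<Sum>n<N. (b n)\<^sup>2 * (cmod (x n))\<^sup>2) + (\<Sum>n<N. (cmod (of_real (\<mu> n) * x n))\<^sup>2) / R\<^sup>2"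
      by (simp add: distrib_right sum.distrib sum_distrib_left sum_divide_distrib norm_mult power_mult_distrib mult.assoc)
    also have "\<dots> \<le> R powr \<alpha> / \<beta>1 * W + (l2n (\<lambda>n. of_real (\<mu> n) * x n))\<^sup>2 / R\<^sup>2"
    proof (intro add_mono mult_left_mono divide_right_mono W)
      show "(\<Sum>n<N. (cmod (of_real (\<mu> n) * x n))\<^sup>2) \<le> (l2n (\<lambda>n. of_real (\<mu> n) * x n))\<^sup>2"
        unfolding l2n_squared[OF mx] using mx unfolding ell2_def by (intro sum_le_suminf) auto
    qed (use low(1) in auto)
    finally show ?thesis .
  qed
  then show ?thesis
    unfolding l2n_squared[OF x] using x unfolding ell2_def by (intro suminf_le_const) auto
qed

end

section \<open>Observability and decay\<close>

context rank_one_damping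
begin

text \<open>Ingham's inequality is applied to the free output \<open>h\<close>, whose distance from
  \<open>Y\<close> is controlled by \<open>out_truncate\<close> and \<open>sol_transport\<close>.
  Then \<open>square_integral_le\<close> passes from the integral of \<open>cmod Y\<close> to that
  of its square, which \<open>sol_energy\<close> identifies with the energy loss.\<close>

lemma observability:
  fixes z :: "nat \<Rightarrow> int"
  assumes z: "inj z" and d: "\<delta> > 0"
    and gap: "\<And>m n. \<delta> * \<bar>real_of_int (z m - z n)\<bar> \<le> \<bar>\<mu> m - \<mu> n\<bar>"
    and T: "T = 12 / \<delta>" and X: "sol X"
  shows "(\<Sum>n<N. (b n)\<^sup>2 * (cmod (X 0 n))\<^sup>2)
      \<le> 9 * (1 + (g * bsq * T)\<^sup>2) / (2 * g * T) * ((l2n (X 0))\<^sup>2 - (l2n (X T))\<^sup>2)"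
proof -
  have T0: "T > 0" using T d by simp
  define Y where "Y t = out (X t)" for t
  define Q where "Q = integral {0..T} (\<lambda>t. cmod (Y t))"
  define J where "J = integral {0..T} (\<lambda>t. (cmod (Y t))\<^sup>2)"
  have Yc: "continuous_on {0..T} Y"
    unfolding Y_def by (rule continuous_on_subset[OF continuous_on_out_sol[OF X]]) auto
  have J: "((\<lambda>t. (cmod (Y t))\<^sup>2) has_integral J) {0..T}"
    unfolding J_def by (intro integrable_integral integrable_continuous_real continuous_intros Yc)
  have Q0: "Q \<ge> 0" unfolding Q_def
    by (intro integral_nonneg integrable_continuous_real continuous_intros Yc) auto
  have QJ: "Q\<^sup>2 \<le> T * J" unfolding Q_def J_def
    by (intro square_integral_le continuous_intros Yc T0)
  obtain M where M: "M \<ge> 0" "\<And>t. t \<in> {0..T} \<Longrightarrow> l2n (X t) \<le> M" using sol_bounded[OF X] by blast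
  define S where "S N = (\<Sum>n<N. (b n)\<^sup>2 * (cmod (X 0 n))\<^sup>2)" for N :: nat
  \<comment> \<open>The bound without truncation error: the outer 3 is Ingham's, the inner ones come
    from squaring a sum of three terms.\<close>
  define C where "C = 3 / T * (3 * J + T * (3 * (g * bsq * Q)\<^sup>2))"
  have SN: "S N \<le> C + 9 * (tail N * M)\<^sup>2" for N
  proof -
    define h where "h t = (\<Sum>n<N. (of_real (b n) * X 0 n) * cis (\<mu> n * t))" for t
    have hb: "(cmod (h t))\<^sup>2 \<le> 3 * (cmod (Y t))\<^sup>2 + (3 * (tail N * M)\<^sup>2 + 3 * (g * bsq * Q)\<^sup>2)"
      if t: "t \<in> {0..T}" for t
    proof -
      have t0: "0 \<le> t" "t \<le> T" using t by auto
      let ?YN = "\<Sum>n<N. of_real (b n) * X t n"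
      have 1: "cmod (Y t - ?YN) \<le> tail N * M"
        using out_truncate[OF sol_ell2[OF X t0(1)], of N] mult_left_mono[OF M(2)[OF t] tail_nonneg[of N]]
        unfolding Y_def by linarith
      have "cmod (?YN - h t) \<le> (\<Sum>n<N. cmod (of_real (b n) * X t n - (of_real (b n) * X 0 n) * cis (\<mu> n * t)))"
        unfolding h_def sum_subtractf[symmetric] by (rule norm_sum)
      also have "\<dots> \<le> (\<Sum>n<N. (b n)\<^sup>2 * (g * Q))"
      proof (rule sum_mono)
        fix n
        have "of_real (b n) * X t n - (of_real (b n) * X 0 n) * cis (\<mu> n * t)
            = of_real (b n) * (X t n - cis (\<mu> n * t) * X 0 n)"
          by (simp add: algebra_simps)
        then have "cmod (of_real (b n) * X t n - (of_real (b n) * X 0 n) * cis (\<mu> n * t))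
            = \<bar>b n\<bar> * cmod (X t n - cis (\<mu> n * t) * X 0 n)"
          by (simp only: norm_mult norm_of_real)
        also have "\<dots> \<le> \<bar>b n\<bar> * (g * \<bar>b n\<bar> * Q)"
          unfolding Q_def Y_def by (intro mult_left_mono sol_transport X t0) auto
        also have "\<dots> = \<bar>b n\<bar>\<^sup>2 * (g * Q)" by (simp only: power2_eq_square mult_ac)
        finally show "cmod (of_real (b n) * X t n - (of_real (b n) * X 0 n) * cis (\<mu> n * t)) \<le> (b n)\<^sup>2 * (g * Q)"
          by simp
      qed
      also have "\<dots> = (\<Sum>n<N. (b n)\<^sup>2) * (g * Q)" by (simp add: sum_distrib_right)
      also have "\<dots> \<le> bsq * (g * Q)"
        unfolding bsq_def using b_l2 g_pos Q0 by (intro mult_right_mono sum_le_suminf) auto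
      finally have 2: "cmod (?YN - h t) \<le> g * bsq * Q" by (simp add: mult_ac)
      have "cmod (h t) \<le> cmod (Y t) + cmod (Y t - ?YN) + cmod (?YN - h t)"
      proof -
        have "h t = Y t - (Y t - ?YN) - (?YN - h t)" by simp
        then show ?thesis by (metis norm_triangle_ineq4 order_trans add_right_mono)
      qed
      also have "\<dots> \<le> cmod (Y t) + tail N * M + g * bsq * Q" using 1 2 by simp
      finally have "(cmod (h t))\<^sup>2 \<le> (cmod (Y t) + tail N * M + g * bsq * Q)\<^sup>2" by (intro power_mono) auto
      also have "\<dots> \<le> 3 * (cmod (Y t))\<^sup>2 + (3 * (tail N * M)\<^sup>2 + 3 * (g * bsq * Q)\<^sup>2)"
      proof -
        have "(x + y + w)\<^sup>2 \<le> 3 * x\<^sup>2 + (3 * y\<^sup>2 + 3 * w\<^sup>2)" for x y w :: real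
        proof -
          have "0 \<le> (x - y)\<^sup>2 + (y - w)\<^sup>2 + (x - w)\<^sup>2" by simp
          then show ?thesis by (simp add: power2_eq_square algebra_simps)
        qed
        then show ?thesis .
      qed
      finally show ?thesis .
    qed
    have hc: "continuous_on {0..T} (\<lambda>t. (cmod (h t))\<^sup>2)"
      unfolding h_def by (intro continuous_intros)
    let ?K = "3 * (tail N * M)\<^sup>2 + 3 * (g * bsq * Q)\<^sup>2"
    have c: "((\<lambda>t. ?K) has_integral (T * ?K)) {0..T}"
      using has_integral_const_real[of ?K 0 T] T0 by simp
    have int: "integral {0..T} (\<lambda>t. (cmod (h t))\<^sup>2) \<le> 3 * J + T * ?K"
      by (rule has_integral_le[OF integrable_integral[OF integrable_continuous_real[OF hc]]
            has_integral_add[OF has_integral_mult_right[OF J] c] hb])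
    have "S N = (\<Sum>n<N. (cmod (of_real (b n) * X 0 n))\<^sup>2)"
      by (simp add: S_def norm_mult power_mult_distrib)
    also have "\<dots> \<le> 3 / T * integral {0..T} (\<lambda>t. (cmod (h t))\<^sup>2)"
      unfolding h_def by (rule Ingham_inequality[OF _ z d gap T]) simp
    also have "\<dots> \<le> 3 / T * (3 * J + T * ?K)"
      using T0 int by (intro mult_left_mono) auto
    also have "\<dots> = C + 9 * (tail N * M)\<^sup>2"
      using T0 by (simp add: C_def field_simps)
    finally show ?thesis .
  qed
  have "S N \<le> C"
  proof (rule LIMSEQ_le_const)
    have "(\<lambda>K. C + 9 * (tail K * M)\<^sup>2) \<longlonglongrightarrow> C + 9 * (0 * M)\<^sup>2"
      by (intro tendsto_intros tail_tendsto)
    then show "(\<lambda>K. C + 9 * (tail K * M)\<^sup>2) \<longlonglongrightarrow> C" by simp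
    \<comment> \<open>Monotonicity of \<open>S\<close> bounds \<open>S N\<close> by the estimate at
      every later truncation level \<open>K\<close>, where the tail term tends to 0.\<close>
    have "S N \<le> S K" if "N \<le> K" for K
      unfolding S_def using that by (intro sum_mono2) auto
    then show "\<exists>N0. \<forall>K\<ge>N0. S N \<le> C + 9 * (tail K * M)\<^sup>2" using SN order_trans by blast
  qed
  also have "C \<le> 9 * (1 + (g * bsq * T)\<^sup>2) / T * J"
  proof -
    have "C = 3 / T * (3 * J + 3 * T * (g * bsq)\<^sup>2 * Q\<^sup>2)" by (simp add: C_def power_mult_distrib)
    also have "\<dots> \<le> 3 / T * (3 * J + 3 * T * (g * bsq)\<^sup>2 * (T * J))"
      using T0 QJ by (intro mult_left_mono add_left_mono) auto
    also have "\<dots> = 9 * (1 + (g * bsq * T)\<^sup>2) / T * J"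
      using T0 by (simp add: field_simps power2_eq_square)
    finally show ?thesis .
  qed
  also have "J = ((l2n (X 0))\<^sup>2 - (l2n (X T))\<^sup>2) / (2 * g)"
    using sol_energy[OF X] T0 g_pos by (simp add: J_def Y_def)
  finally show ?thesis by (simp add: S_def mult_ac)
qed

text \<open>Sampling at multiples of \<open>T\<close> combines \<open>observability\<close> and
  \<open>l2n_interpolation\<close> into the hypothesis of \<open>power_decay_recurrence\<close>;
  monotonicity of the norm covers the times in between.\<close>

theorem polynomial_decay:
  fixes z :: "nat \<Rightarrow> int"
  assumes z: "inj z" and d: "\<delta> > 0"
    and gap: "\<And>m n. \<delta> * \<bar>real_of_int (z m - z n)\<bar> \<le> \<bar>\<mu> m - \<mu> n\<bar>"
    and m: "m > 0" "\<And>n. m \<le> \<bar>\<mu> n\<bar>"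
    and low: "\<beta>1 > 0" "\<And>n. \<beta>1 \<le> (b n)\<^sup>2 * \<bar>\<mu> n\<bar> powr \<alpha>" and al: "\<alpha> > 0"
  shows "\<exists>C. \<forall>X. sol X \<longrightarrow> (\<forall>t\<ge>0. l2n (X t) \<le> C * (t + 1) powr (- 1 / \<alpha>) * l2n (gen (X 0)))"
proof -
  define T where "T = 12 / \<delta>"
  have T0: "T > 0" using d by (simp add: T_def)
  define P where "P = 9 * (1 + (g * bsq * T)\<^sup>2) / (2 * g * T)"
  have P0: "P > 0" unfolding P_def using T0 g_pos by (intro divide_pos_pos mult_pos_pos) (auto intro: add_pos_nonneg)
  define s where "s = \<alpha> / 2"
  have s0: "s > 0" using al by (simp add: s_def)
  \<comment> \<open>Here \<open>P\<close> comes from observability, \<open>\<beta>1\<close> and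
    \<open>2 powr s\<close> from interpolation at the cutoff \<open>R\<close>, and the factor 2 from
    absorbing half of \<open>u k\<close>.\<close>
  define \<eta> where "\<eta> = \<beta>1 / (2 * P * 2 powr s)"
  have eta0: "\<eta> > 0" using low(1) P0 by (simp add: \<eta>_def)
  \<comment> \<open>The constant of \<open>power_decay_recurrence\<close> for the initial bound
    \<open>1 / m^2\<close>, which \<open>u00\<close> supplies.\<close>
  define a where "a = min ((1 / m\<^sup>2) powr (- s)) (s * \<eta>)"
  have a0: "a > 0" using m(1) s0 eta0 by (simp add: a_def)
  define K where "K = 1 + g * bsq / m"
  have K0: "K > 0" using m(1) g_pos bsq_nonneg by (auto simp: K_def intro!: add_pos_nonneg divide_nonneg_pos)
  define C where "C = K * (a / (T + 1)) powr (- 1 / \<alpha>)"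
  have "l2n (X t) \<le> C * (t + 1) powr (- 1 / \<alpha>) * l2n (gen (X 0))" if X: "sol X" and t: "t \<ge> 0" for X t
  proof -
    \<comment> \<open>\<open>L\<close> bounds the \<open>\<mu>\<close>-weighted norm at all times;
      dividing the energies by \<open>L^2\<close> makes the recurrence independent of the initial
      data.\<close>
    define L where "L = K * l2n (gen (X 0))"
    have L0: "L \<ge> 0" using K0 l2n_nonneg[OF sol_ell2_gen[OF X, of 0]] by (simp add: L_def)
    have mL: "l2n (\<lambda>n. of_real (\<mu> n) * X r n) \<le> L" if r: "r \<ge> 0" for r
    proof -
      have "l2n (\<lambda>n. of_real (\<mu> n) * X r n) \<le> K * l2n (gen (X r))"
        unfolding K_def by (rule l2n_mu_le_gen[OF m sol_ell2[OF X r] sol_ell2_mu[OF X r]])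
      also have "\<dots> \<le> L" unfolding L_def using K0 sol_gen_contractive[OF X r] by (intro mult_left_mono) auto
      finally show ?thesis .
    qed
    have XL: "l2n (X r) \<le> L / m" if r: "r \<ge> 0" for r
    proof -
      have e: "ell2 (\<lambda>n. (1 / of_real m) * (of_real (\<mu> n) * X r n))"
        by (rule ell2_cmult[OF sol_ell2_mu[OF X r]])
      have "cmod (X r n) \<le> cmod ((1 / of_real m) * (of_real (\<mu> n) * X r n))" for n
      proof -
        have "m * cmod (X r n) \<le> \<bar>\<mu> n\<bar> * cmod (X r n)" by (intro mult_right_mono m) auto
        then show ?thesis using m(1) by (simp add: norm_mult norm_divide field_simps)
      qed
      then have "l2n (X r) \<le> l2n (\<lambda>n. (1 / of_real m) * (of_real (\<mu> n) * X r n))"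
        by (rule l2n_norm_le(2)[OF e])
      also have "\<dots> = l2n (\<lambda>n. of_real (\<mu> n) * X r n) / m"
        using l2n_cmult[OF sol_ell2_mu[OF X r], of "1 / of_real m"] m(1) by (simp add: norm_divide)
      also have "\<dots> \<le> L / m" using mL[OF r] m(1) by (intro divide_right_mono) auto
      finally show ?thesis .
    qed
    show ?thesis
    proof (cases "L = 0")
      case True
      then have "l2n (X t) \<le> 0" "l2n (gen (X 0)) = 0" using XL[OF t] K0 by (auto simp: L_def)
      then show ?thesis by simp
    next
      case False
      then have Lp: "L > 0" using L0 by simp
      define u where "u k = (l2n (X (real k * T)) / L)\<^sup>2" for k
      have kT: "real k * T \<ge> 0" for k using T0 by simp
      have step: "u (Suc k) \<le> u k - \<eta> * u k powr (1 + s)" for k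
      proof (cases "u k = 0")
        case True
        then have "l2n (X (real k * T)) = 0" using Lp by (simp add: u_def)
        moreover have "l2n (X (real (Suc k) * T)) \<le> l2n (X (real k * T))"
          using T0 by (intro sol_antimono[OF X kT]) (simp add: algebra_simps)
        moreover have "0 \<le> l2n (X (real (Suc k) * T))" by (rule l2n_nonneg[OF sol_ell2[OF X kT]])
        ultimately show ?thesis using True by (simp add: u_def)
      next
        case False
        then have u0: "u k > 0" by (simp add: u_def)
        \<comment> \<open>This cutoff makes the high-frequency term \<open>L^2 / R^2\<close> half of
          the energy \<open>L^2 * u k\<close>, so it is absorbed on the left. For
          \<open>u k = 0\<close> the formula gives no positive cutoff, whence the case
          split.\<close>
        define R where "R = sqrt (2 / u k)"
        have R0: "R > 0" using u0 by (simp add: R_def)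
        have R2: "R\<^sup>2 = 2 / u k" using u0 by (simp add: R_def)
        have Ra: "R powr \<alpha> = 2 powr s / u k powr s"
        proof -
          have "R powr \<alpha> = ((2 / u k) powr (1/2)) powr \<alpha>" using u0 by (simp add: R_def powr_half_sqrt)
          also have "\<dots> = (2 / u k) powr s" by (simp add: powr_powr s_def)
          also have "\<dots> = 2 powr s / u k powr s" using u0 by (simp add: powr_divide)
          finally show ?thesis .
        qed
        let ?E = "\<lambda>k. (l2n (X (real k * T)))\<^sup>2"
        have E: "?E k = L\<^sup>2 * u k" for k using Lp by (simp add: u_def power_divide)
        have W: "(\<Sum>n<N. (b n)\<^sup>2 * (cmod (X (real k * T) n))\<^sup>2) \<le> P * (?E k - ?E (Suc k))" for N
          using observability[OF z d gap T_def sol_shift[OF X kT[of k]], of N]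
          unfolding P_def by (simp add: algebra_simps)
        have "?E k \<le> R powr \<alpha> / \<beta>1 * (P * (?E k - ?E (Suc k))) + (l2n (\<lambda>n. of_real (\<mu> n) * X (real k * T) n))\<^sup>2 / R\<^sup>2"
          by (rule l2n_interpolation[OF low al R0 sol_ell2[OF X kT] sol_ell2_mu[OF X kT] W])
        also have "\<dots> \<le> R powr \<alpha> / \<beta>1 * (P * (?E k - ?E (Suc k))) + L\<^sup>2 / R\<^sup>2"
          using mL[OF kT[of k]] l2n_nonneg[OF sol_ell2_mu[OF X kT[of k]]]
          by (intro add_left_mono divide_right_mono power_mono) auto
        finally have "L\<^sup>2 * u k \<le> L\<^sup>2 * (2 powr s / u k powr s / \<beta>1 * (P * (u k - u (Suc k))) + u k / 2)"
          unfolding E R2 Ra by (simp add: algebra_simps diff_divide_distrib)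
        then have "u k \<le> 2 powr s / u k powr s / \<beta>1 * (P * (u k - u (Suc k))) + u k / 2"
          using Lp by (subst (asm) mult_le_cancel_left_pos) auto
        moreover have "2 powr s / u k powr s / \<beta>1 * (P * (u k - u (Suc k))) = (2 powr s * P / (u k powr s * \<beta>1)) * (u k - u (Suc k))"
          by simp
        ultimately have "u k / 2 \<le> (2 powr s * P / (u k powr s * \<beta>1)) * (u k - u (Suc k))" by linarith
        then have "(u k / 2) * (u k powr s * \<beta>1 / (2 powr s * P)) \<le> (2 powr s * P / (u k powr s * \<beta>1)) * (u k - u (Suc k)) * (u k powr s * \<beta>1 / (2 powr s * P))"
          using u0 low(1) P0 by (intro mult_right_mono) auto
        also have "\<dots> = u k - u (Suc k)" using u0 low(1) P0 by simp
        also have "(u k / 2) * (u k powr s * \<beta>1 / (2 powr s * P)) = \<eta> * u k powr (1 + s)"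
          using u0 by (simp add: \<eta>_def powr_add mult_ac)
        finally show ?thesis by simp
      qed
      have u00: "u 0 \<le> 1 / m\<^sup>2"
      proof -
        have "l2n (X 0) / L \<le> 1 / m" using XL[of 0] Lp m(1) by (simp add: field_simps)
        then have "(l2n (X 0) / L)\<^sup>2 \<le> (1 / m)\<^sup>2"
          using l2n_nonneg[OF sol_ell2[OF X, of 0]] Lp by (intro power_mono) auto
        then show ?thesis by (simp add: u_def power_divide)
      qed
      define k where "k = nat \<lfloor>t / T\<rfloor>"
      have k1: "real k * T \<le> t" using T0 t by (simp add: k_def flip: pos_le_divide_eq)
      have k2: "t \<le> (real k + 1) * T"
      proof -
        have "t / T \<le> real k + 1" using T0 t by (simp add: k_def)
        then show ?thesis using T0 by (simp add: pos_divide_le_eq)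
      qed
      have uk: "u k \<le> (a * (real k + 1)) powr (- 1 / s)"
        by (rule power_decay_recurrence[OF s0 eta0 _ u00 _ step a_def]) (use m(1) in \<open>auto simp: u_def\<close>)
      \<comment> \<open>From \<open>t \<le> (k + 1) * T\<close> and \<open>1 \<le> k + 1\<close>:
        the step count is traded for time at the cost of \<open>T + 1\<close> in the
        constant.\<close>
      have "t + 1 \<le> (real k + 1) * (T + 1)" using k2 by (simp add: algebra_simps)
      then have "a / (T + 1) * (t + 1) \<le> a / (T + 1) * ((real k + 1) * (T + 1))"
        using a0 T0 by (intro mult_left_mono) auto
      also have "\<dots> = a * (real k + 1)" using T0 by simp
      finally have ak: "a / (T + 1) * (t + 1) \<le> a * (real k + 1)" .
      have "l2n (X t) / L \<le> l2n (X (real k * T)) / L"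
        using Lp by (intro divide_right_mono sol_antimono[OF X kT k1]) auto
      also have "\<dots> = sqrt (u k)"
        using Lp l2n_nonneg[OF sol_ell2[OF X kT[of k]]] by (simp add: u_def)
      also have "\<dots> \<le> sqrt ((a * (real k + 1)) powr (- 1 / s))" using uk by simp
      \<comment> \<open>As \<open>s = \<alpha> / 2\<close>, the square root halves the exponent
        \<open>- 2 / \<alpha>\<close>.\<close>
      also have "\<dots> = (a * (real k + 1)) powr (- 1 / \<alpha>)"
        by (simp add: powr_half_sqrt[symmetric] powr_powr s_def)
      also have "\<dots> \<le> (a / (T + 1) * (t + 1)) powr (- 1 / \<alpha>)"
        using ak a0 T0 t al by (intro powr_mono2') auto
      also have "\<dots> = (a / (T + 1)) powr (- 1 / \<alpha>) * (t + 1) powr (- 1 / \<alpha>)"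
        by (rule powr_mult)
      finally have "l2n (X t) \<le> (a / (T + 1)) powr (- 1 / \<alpha>) * (t + 1) powr (- 1 / \<alpha>) * L"
        using Lp by (simp add: pos_divide_le_eq)
      then show ?thesis by (simp add: C_def L_def mult_ac)
    qed
  qed
  then show ?thesis by blast
qed

end

section \<open>The observer error system\<close>

lemma sums_interleave:
  fixes f h :: "nat \<Rightarrow> 'a::real_normed_vector"
  assumes "f sums x" "h sums y"
  shows "(\<lambda>n. if even n then f (n div 2) else h (n div 2)) sums (x + y)"
proof -
  have "(\<lambda>n. if even n then f (n div 2) else 0) sums x"
  proof -
    have "(\<lambda>k. (\<lambda>n. if even n then f (n div 2) else 0) (2 * k)) sums x" using assms(1) by simp
    then show ?thesis
      by (subst (asm) sums_mono_reindex) (auto simp: strict_mono_def elim!: evenE)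
  qed
  moreover have "(\<lambda>n. if even n then 0 else h (n div 2)) sums y"
  proof -
    have "(\<lambda>k. (\<lambda>n. if even n then 0 else h (n div 2)) (2 * k + 1)) sums y" using assms(2) by simp
    then show ?thesis
      by (subst (asm) sums_mono_reindex) (auto simp: strict_mono_def elim!: oddE)
  qed
  ultimately have "(\<lambda>n. (if even n then f (n div 2) else 0) + (if even n then 0 else h (n div 2))) sums (x + y)"
    by (rule sums_add)
  then show ?thesis by (rule back_subst[where P="\<lambda>f. f sums _"]) auto
qed

text \<open>Identifies H isometrically with one sequence space, so that the coupled blocks become a
  single diagonal system with damping.\<close>

definition interleave :: "hvec \<Rightarrow> nat \<Rightarrow> complex" where
  "interleave v n = (if even n then fst v (n div 2) else snd v (n div 2))"

lemma
  assumes "inH v"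
  shows ell2_interleave: "ell2 (interleave v)" and l2n_interleave: "l2n (interleave v) = Hnorm v"
proof -
  have "(\<lambda>n. if even n then (cmod (fst v (n div 2)))\<^sup>2 else (cmod (snd v (n div 2)))\<^sup>2) sums
      ((\<Sum>j. (cmod (fst v j))\<^sup>2) + (\<Sum>j. (cmod (snd v j))\<^sup>2))"
    using assms unfolding inH_def ell2_def by (intro sums_interleave summable_sums) auto
  then have "(\<lambda>n. (cmod (interleave v n))\<^sup>2) sums ((\<Sum>j. (cmod (fst v j))\<^sup>2) + (\<Sum>j. (cmod (snd v j))\<^sup>2))"
    by (rule back_subst[where P="\<lambda>f. f sums _"]) (auto simp: interleave_def)
  then show "ell2 (interleave v)" "l2n (interleave v) = Hnorm v"
    by (auto simp: ell2_def l2n_def Hnorm_def sums_iff)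
qed

text \<open>The converse of \<open>ell2_interleave\<close>, needed because
  \<open>l2n_interleave\<close> applies only to vectors already known to lie in H.\<close>

lemma ell2_interleaveD:
  assumes "ell2 (interleave v)"
  shows "inH v"
proof -
  have s: "summable (\<lambda>n. (cmod (interleave v n))\<^sup>2)" using assms by (simp add: ell2_def)
  have "summable (\<lambda>j. (cmod (interleave v (2 * j)))\<^sup>2)"
    using s by (rule summable_reindex[where g="\<lambda>j. 2 * j", simplified comp_def]) (auto simp: inj_on_def)
  moreover have "summable (\<lambda>j. (cmod (interleave v (2 * j + 1)))\<^sup>2)"
    using s by (rule summable_reindex[where g="\<lambda>j. 2 * j + 1", simplified comp_def]) (auto simp: inj_on_def)
  ultimately show ?thesis by (simp add: inH_def ell2_def interleave_def)
qed

section \<open>Uniform separation of the signed frequencies\<close>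

lemma increment_ge_gap:
  fixes \<omega> :: "nat \<Rightarrow> real"
  assumes "\<And>j. \<kappa> \<le> \<omega> (Suc j) - \<omega> j" "i \<le> j"
  shows "\<kappa> * (real j - real i) \<le> \<omega> j - \<omega> i"
  using assms(2)
proof (induction j rule: dec_induct)
  case (step j)
  then show ?case using assms(1)[of j] by (simp add: algebra_simps)
qed simp

text \<open>The rank of the \<open>n\<close>-th interleaved frequency in the ordered list \<open>\<dots> < -\<omega> 1 < -\<omega> 0 < \<omega> 0 < \<omega> 1 < \<dots>\<close>\<close>
definition mode_position :: "nat \<Rightarrow> int" where
  "mode_position n = (if even n then - int (n div 2) - 1 else int (n div 2))"

lemma inj_mode_position: "inj mode_position"
  by (auto simp: inj_def mode_position_def elim!: evenE oddE split: if_splits)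

text \<open>Equal signs reduce to accumulated increments of \<open>\<omega>\<close>. For opposite
  signs the positions differ by \<open>i + j + 1\<close>, and \<open>\<omega> i + \<omega> j\<close>
  consists of two accumulated increments from \<open>\<omega> 0\<close> plus
  \<open>2 * \<omega> 0\<close>, which pays for the extra 1.\<close>

lemma signed_frequency_gap:
  fixes \<omega> :: "nat \<Rightarrow> real"
  assumes gap: "\<And>j. \<kappa> \<le> \<omega> (Suc j) - \<omega> j" and d: "0 < \<delta>" "\<delta> \<le> \<kappa>" "\<delta> \<le> 2 * \<omega> 0"
    and \<mu>: "\<mu> = (\<lambda>n. if even n then - \<omega> (n div 2) else \<omega> (n div 2))"
  shows "\<delta> * \<bar>real_of_int (mode_position m - mode_position n)\<bar> \<le> \<bar>\<mu> m - \<mu> n\<bar>"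
proof -
  have inc: "\<delta> * (real j - real i) \<le> \<omega> j - \<omega> i" if "i \<le> j" for i j
  proof -
    have "\<delta> * (real j - real i) \<le> \<kappa> * (real j - real i)" using d that by (intro mult_right_mono) auto
    also have "\<dots> \<le> \<omega> j - \<omega> i" by (rule increment_ge_gap[of \<kappa> \<omega>, OF gap that])
    finally show ?thesis .
  qed
  have same: "\<delta> * \<bar>real i - real j\<bar> \<le> \<bar>\<omega> i - \<omega> j\<bar>" for i j
    using inc[of i j] inc[of j i] by (cases "i \<le> j") (auto simp: abs_if algebra_simps)
  have opp: "\<delta> * (real i + real j + 1) \<le> \<omega> i + \<omega> j" for i j
    using inc[of 0 i] inc[of 0 j] d by (simp add: algebra_simps)
  have opp': "\<delta> * (real i + real j + 1) \<le> \<bar>\<omega> i + \<omega> j\<bar>" for i j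
    using opp[of i j] by linarith
  let ?i = "m div 2" and ?j = "n div 2"
  show ?thesis
  proof (cases "even m"; cases "even n")
    assume *: "even m" "even n"
    have "\<bar>real_of_int (mode_position m - mode_position n)\<bar> = \<bar>real ?i - real ?j\<bar>" "\<bar>\<mu> m - \<mu> n\<bar> = \<bar>\<omega> ?i - \<omega> ?j\<bar>"
      using * unfolding \<mu> mode_position_def by auto
    then show ?thesis using same[of ?i ?j] by simp
  next
    assume *: "even m" "odd n"
    have "\<bar>real_of_int (mode_position m - mode_position n)\<bar> = real ?i + real ?j + 1" "\<bar>\<mu> m - \<mu> n\<bar> = \<bar>\<omega> ?i + \<omega> ?j\<bar>"
      using * unfolding \<mu> mode_position_def by auto
    then show ?thesis using opp'[of ?i ?j] by simp
  next
    assume *: "odd m" "even n"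
    have "\<bar>real_of_int (mode_position m - mode_position n)\<bar> = real ?i + real ?j + 1" "\<bar>\<mu> m - \<mu> n\<bar> = \<bar>\<omega> ?i + \<omega> ?j\<bar>"
      using * unfolding \<mu> mode_position_def by auto
    then show ?thesis using opp'[of ?i ?j] by simp
  next
    assume *: "odd m" "odd n"
    have "\<bar>real_of_int (mode_position m - mode_position n)\<bar> = \<bar>real ?i - real ?j\<bar>" "\<bar>\<mu> m - \<mu> n\<bar> = \<bar>\<omega> ?i - \<omega> ?j\<bar>"
      using * unfolding \<mu> mode_position_def by auto
    then show ?thesis using same[of ?i ?j] by simp
  qed
qed

section \<open>The observer error as a damped diagonal system\<close>

locale observer_error =
  fixes \<omega> c :: "nat \<Rightarrow> real" and \<gamma> :: real
  assumes gamma_pos: "\<gamma> > 0" and c_l2: "summable (\<lambda>j. (c j)\<^sup>2)"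
begin

text \<open>Each \<open>c j\<close> occurs twice, once with frequency \<open>- \<omega> j\<close>
  and once with \<open>\<omega> j\<close>; the gain is the factor \<open>\<gamma> / 2\<close> of
  \<open>Acheck\<close>.\<close>

sublocale rank_one_damping "\<lambda>n. if even n then - \<omega> (n div 2) else \<omega> (n div 2)" "\<lambda>n. c (n div 2)" "\<gamma> / 2"
proof
  have "summable (\<lambda>n. if even n then (c (n div 2))\<^sup>2 else (c (n div 2))\<^sup>2)"
    using sums_interleave[OF summable_sums[OF c_l2] summable_sums[OF c_l2]] by (rule sums_summable)
  then show "summable (\<lambda>n. (c (n div 2))\<^sup>2)" by simp
qed (use gamma_pos in simp)

text \<open>All four \<open>Acheck\<close> blocks have the same kernel, so both components are
  driven by the sum of the two output series, which is \<open>out\<close> of the interleaved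
  vector.\<close>

lemma gen_interleave:
  assumes "inH v"
  shows "gen (interleave v) = interleave (Aop \<omega> c \<gamma> v)"
proof -
  have c: "ell2 (\<lambda>j. of_real (c j))" using c_l2 by (simp add: ell2_def)
  have s: "summable (\<lambda>j. of_real (c j) * fst v j)" "summable (\<lambda>j. of_real (c j) * snd v j)"
    using assms l2n_Cauchy_Schwarz(1)[OF c] unfolding inH_def by (auto intro: summable_norm_cancel)
  have "(\<lambda>n. of_real (c (n div 2)) * interleave v n) sums
      ((\<Sum>j. of_real (c j) * fst v j) + (\<Sum>j. of_real (c j) * snd v j))"
    using sums_interleave[OF summable_sums[OF s(1)] summable_sums[OF s(2)]]
    by (rule back_subst[where P="\<lambda>f. f sums _"]) (auto simp: interleave_def)
  then have out: "out (interleave v) = (\<Sum>j. of_real (c j) * fst v j) + (\<Sum>j. of_real (c j) * snd v j)"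
    unfolding out_def by (simp add: sums_iff)
  show ?thesis
    by (rule ext) (simp add: gen_def out interleave_def Aop_def Acheck_def algebra_simps)
qed

text \<open>Interleaving is linear and isometric and intertwines \<open>Aop\<close> with
  \<open>gen\<close>; what remains is the change from increments \<open>h\<close> to times
  \<open>s = t + h\<close>.\<close>

lemma sol_interleave:
  assumes "is_solution \<omega> c \<gamma> \<epsilon>"
  shows "sol (\<lambda>t. interleave (\<epsilon> t))"
  unfolding sol_def
proof (intro allI impI conjI)
  fix t :: real assume t: "t \<ge> 0"
  have H: "inH (\<epsilon> s)" if "s \<ge> 0" for s using assms that by (simp add: is_solution_def domA_def)
  show "ell2 (interleave (\<epsilon> t))" by (rule ell2_interleave[OF H[OF t]])
  show em: "ell2 (\<lambda>n. of_real (if even n then - \<omega> (n div 2) else \<omega> (n div 2)) * interleave (\<epsilon> t) n)"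
  proof -
    let ?v = "((\<lambda>j. of_real (- \<omega> j) * fst (\<epsilon> t) j), (\<lambda>j. of_real (\<omega> j) * snd (\<epsilon> t) j))"
    have s: "summable (\<lambda>j. (\<omega> j)\<^sup>2 * ((cmod (fst (\<epsilon> t) j))\<^sup>2 + (cmod (snd (\<epsilon> t) j))\<^sup>2))"
      using assms t by (simp add: is_solution_def domA_def)
    have "inH ?v" unfolding inH_def ell2_def
      by (auto intro!: summable_comparison_test[OF _ s] exI[of _ 0] mult_left_mono
          simp: norm_mult power_mult_distrib)
    from ell2_interleave[OF this] show ?thesis
      by (rule back_subst[where P=ell2]) (auto simp: interleave_def)
  qed
  let ?D = "\<lambda>h. Hdiff (Hscale (1 / h) (Hdiff (\<epsilon> (t + h)) (\<epsilon> t))) (Aop \<omega> c \<gamma> (\<epsilon> t))"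
  have lim: "((\<lambda>h. Hnorm (?D h)) \<longlongrightarrow> 0) (at 0 within {h. 0 \<le> t + h})"
    using assms t by (simp add: is_solution_def)
  have "filterlim (\<lambda>s. s - t) (at 0 within {h. 0 \<le> t + h}) (at t within {0..})"
    unfolding filterlim_at
    by (auto intro!: tendsto_eq_intros simp: eventually_at_filter)
  from filterlim_compose[OF lim this]
  have "((\<lambda>s. Hnorm (?D (s - t))) \<longlongrightarrow> 0) (at t within {0..})" .
  then show "((\<lambda>s. l2n (\<lambda>n. (interleave (\<epsilon> s) n - interleave (\<epsilon> t) n) / of_real (s - t) - gen (interleave (\<epsilon> t)) n)) \<longlongrightarrow> 0)
      (at t within {0..})"
  proof (rule Lim_transform_eventually)
    show "\<forall>\<^sub>F s in at t within {0..}. Hnorm (?D (s - t)) =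
        l2n (\<lambda>n. (interleave (\<epsilon> s) n - interleave (\<epsilon> t) n) / of_real (s - t) - gen (interleave (\<epsilon> t)) n)"
      unfolding eventually_at_filter
    proof (intro always_eventually allI impI)
      fix s assume "s \<noteq> t" "s \<in> {0..}"
      then have s: "s \<ge> 0" by simp
      have eq: "(\<lambda>n. (interleave (\<epsilon> s) n - interleave (\<epsilon> t) n) / of_real (s - t) - gen (interleave (\<epsilon> t)) n)
          = interleave (?D (s - t))"
        by (auto simp: gen_interleave[OF H[OF t]] interleave_def Hdiff_def Hscale_def)
      \<comment> \<open>\<open>Hnorm\<close> and \<open>l2n\<close> are identified only on H, so the
        error of the quotient is first shown to lie there.\<close>
      have "ell2 (\<lambda>n. (1 / of_real (s - t)) * (interleave (\<epsilon> s) n - interleave (\<epsilon> t) n) - gen (interleave (\<epsilon> t)) n)"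
        by (intro ell2_diff ell2_cmult ell2_interleave H s t ell2_gen em)
      then have "ell2 (interleave (?D (s - t)))" unfolding eq[symmetric] by simp
      then show "Hnorm (?D (s - t)) =
        l2n (\<lambda>n. (interleave (\<epsilon> s) n - interleave (\<epsilon> t) n) / of_real (s - t) - gen (interleave (\<epsilon> t)) n)"
        unfolding eq by (simp add: l2n_interleave ell2_interleaveD)
    qed
  qed
qed

lemma inH_Aop_solution:
  assumes "is_solution \<omega> c \<gamma> \<epsilon>" "t \<ge> 0"
  shows "inH (Aop \<omega> c \<gamma> (\<epsilon> t))"
proof (rule ell2_interleaveD)
  have "inH (\<epsilon> t)" using assms by (simp add: is_solution_def domA_def)
  then show "ell2 (interleave (Aop \<omega> c \<gamma> (\<epsilon> t)))"
    using sol_ell2_gen[OF sol_interleave[OF assms(1)] assms(2)] by (simp add: gen_interleave)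
qed

end

section \<open>Decay of the observer error\<close>

theorem theorem2p1:
  fixes \<omega> c :: "nat \<Rightarrow> real" and \<gamma> \<kappa> \<alpha> \<beta> :: real and k0 :: nat
  assumes gamma_pos: "\<gamma> > 0"
    and c_l2: "summable (\<lambda>j. (c j)\<^sup>2)"
    and A1_pos: "0 < \<omega> 0"
    and A1_incr: "\<forall>j. \<omega> j < \<omega> (Suc j)"
    and A1_c: "\<forall>j. c j \<noteq> 0"
    and A2: "\<kappa> > 0" "\<forall>j. \<omega> (Suc j) - \<omega> j \<ge> \<kappa>"
    and A3: "\<alpha> > 0" "\<beta> > 0" "\<forall>k\<ge>k0. \<bar>c k\<bar> * (\<omega> k) powr (\<alpha> / 2) \<ge> \<beta>"
  shows "\<exists>\<beta>t\<ge>\<beta>. \<forall>\<epsilon>. is_solution \<omega> c \<gamma> \<epsilon> \<longrightarrow>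
           (\<forall>t\<ge>0. Hnorm (\<epsilon> t) \<le> \<beta>t * (t + 1) powr (- 1 / \<alpha>) * Hnorm (Aop \<omega> c \<gamma> (\<epsilon> 0)))"
proof -
  interpret observer_error \<omega> c \<gamma> by (rule observer_error.intro[OF gamma_pos c_l2])
  let ?\<mu> = "\<lambda>n. if even n then - \<omega> (n div 2) else \<omega> (n div 2)"
  have mono: "\<omega> 0 \<le> \<omega> j" for j
    by (rule lift_Suc_mono_le[of \<omega>]) (use A1_incr in \<open>auto intro: less_imp_le\<close>)
  have pos: "0 < \<omega> j" for j using mono[of j] A1_pos by linarith
  \<comment> \<open>\<open>\<kappa>\<close> separates neighbouring frequencies of equal sign,
    \<open>2 * \<omega> 0\<close> the two nearest to zero.\<close>
  define \<delta> where "\<delta> = min \<kappa> (2 * \<omega> 0)"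
  have d: "0 < \<delta>" "\<delta> \<le> \<kappa>" "\<delta> \<le> 2 * \<omega> 0" using A2 A1_pos by (auto simp: \<delta>_def)
  have gap: "\<delta> * \<bar>real_of_int (mode_position m - mode_position n)\<bar> \<le> \<bar>?\<mu> m - ?\<mu> n\<bar>" for m n
    by (rule signed_frequency_gap[of \<kappa> \<omega>, OF _ d]) (use A2 in auto)
  have mu: "\<bar>?\<mu> n\<bar> = \<omega> (n div 2)" for n using pos[of "n div 2"] by auto
  \<comment> \<open>The finitely many modes below \<open>k0\<close> contribute their own values,
    positive because \<open>c k\<close> does not vanish; inserting \<open>\<beta>^2\<close> covers
    the rest and keeps the set nonempty when \<open>k0 = 0\<close>.\<close>
  define \<beta>1 where "\<beta>1 = Min (insert (\<beta>\<^sup>2) ((\<lambda>k. (c k)\<^sup>2 * \<omega> k powr \<alpha>) ` {..<k0}))"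
  have b1: "\<beta>1 > 0" unfolding \<beta>1_def using A3(2) A1_c pos by (subst Min_gr_iff) (auto intro!: mult_pos_pos simp: less_imp_neq[THEN not_sym])
  have low: "\<beta>1 \<le> (c k)\<^sup>2 * \<omega> k powr \<alpha>" for k
  proof (cases "k < k0")
    case True
    then show ?thesis unfolding \<beta>1_def by (intro Min_le) auto
  next
    case False
    have "\<beta>1 \<le> \<beta>\<^sup>2" unfolding \<beta>1_def by (intro Min_le) auto
    also have "\<dots> \<le> (\<bar>c k\<bar> * \<omega> k powr (\<alpha> / 2))\<^sup>2" using A3 False by (intro power_mono) auto
    also have "\<dots> = (c k)\<^sup>2 * (\<omega> k powr (\<alpha> / 2) * \<omega> k powr (\<alpha> / 2))" by (simp add: power_mult_distrib power2_eq_square)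
    also have "\<omega> k powr (\<alpha> / 2) * \<omega> k powr (\<alpha> / 2) = \<omega> k powr \<alpha>" by (simp flip: powr_add)
    finally show ?thesis .
  qed
  \<comment> \<open>The lower bound \<open>m\<close> on the frequencies is taken to be
    \<open>\<omega> 0\<close>.\<close>
  obtain C where C: "\<And>X t. sol X \<Longrightarrow> t \<ge> 0 \<Longrightarrow> l2n (X t) \<le> C * (t + 1) powr (- 1 / \<alpha>) * l2n (gen (X 0))"
    using polynomial_decay[OF inj_mode_position d(1) gap A1_pos, of \<beta>1 \<alpha>] b1 low mono A3(1) unfolding mu by blast
  show ?thesis
  \<comment> \<open>The maximum secures the required lower bound \<open>\<beta>\<close> on the
    constant and only weakens the estimate.\<close>
  proof (intro exI[of _ "max \<beta> C"] conjI allI impI)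
    fix \<epsilon> and t :: real assume e: "is_solution \<omega> c \<gamma> \<epsilon>" and t: "t \<ge> 0"
    have H: "inH (\<epsilon> s)" if "s \<ge> 0" for s using e that by (simp add: is_solution_def domA_def)
    have A: "inH (Aop \<omega> c \<gamma> (\<epsilon> 0))" by (rule inH_Aop_solution[OF e]) simp
    have A0: "0 \<le> Hnorm (Aop \<omega> c \<gamma> (\<epsilon> 0))"
      using l2n_nonneg[OF ell2_interleave[OF A]] by (simp add: l2n_interleave[OF A])
    have "Hnorm (\<epsilon> t) \<le> C * (t + 1) powr (- 1 / \<alpha>) * Hnorm (Aop \<omega> c \<gamma> (\<epsilon> 0))"
      using C[OF sol_interleave[OF e] t] H[OF t] H[of 0] A by (simp add: l2n_interleave gen_interleave)
    also have "\<dots> \<le> max \<beta> C * (t + 1) powr (- 1 / \<alpha>) * Hnorm (Aop \<omega> c \<gamma> (\<epsilon> 0))"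
      using A0 by (intro mult_right_mono) auto
    finally show "Hnorm (\<epsilon> t) \<le> max \<beta> C * (t + 1) powr (- 1 / \<alpha>) * Hnorm (Aop \<omega> c \<gamma> (\<epsilon> 0))" .
  qed simp
qed

end
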